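(* For $q\in\mathbb{C}$ with $|q|<1$, $$\sum_{i,j\geq 0} \frac{q^{i^2+2ij+2j^2}}{(q;q)_{i}(q;q)_{2j}}=\frac{(q^{3},q^{13},q^{16};q^{16})_{\infty}(q^{10},q^{22};q^{32})_{\infty}}{(q;q)_{\infty}},\quad \sum_{i,j\geq 0}\frac{q^{i^2+2ij+2j^2+i+2j}}{(q;q)_{i}(q;q)_{2j+1}}=\frac{(q^{5},q^{11},q^{16};q^{16})_{\infty}(q^{6},q^{26};q^{32})_{\infty}}{(q;q)_{\infty}},$$ $$\sum_{i,j\geq 0}\frac{q^{i^2+2ij+2j^2+j}}{(q;q)_{i}(q;q)_{2j}}=\frac{(q^{2},q^{14},q^{16};q^{16})_{\infty}(q^{12},q^{20};q^{32})_{\infty}}{(q;q)_{\infty}},\quad \sum_{i,j\geq 0}\frac{q^{i^2+2ij+2j^2+i+3j}}{(q;q)_{i}(q;q)_{2j+1}}=\frac{(q^{6},q^{10},q^{16};q^{16})_{\infty}(q^{4},q^{28};q^{32})_{\infty}}{(q;q)_{\infty}},$$ $$\sum_{i,j\geq 0} \frac{q^{i^2+2ij+2j^2+i+2j}}{(q;q)_{i}(q;q)_{2j}}= \frac{(q,q^{15},q^{16};q^{16})_{\infty}(q^{14},q^{18};q^{32})_{\infty}}{(q;q)_{\infty}},\quad \sum_{i,j\geq 0}\frac{q^{i^2+2ij+2j^2+2i+4j}}{(q;q)_{i}(q;q)_{2j+1}}=\frac{(q^{7},q^{9},q^{16};q^{16})_{\infty}(q^{2},q^{30};q^{32})_{\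infty}}{(q;q)_{\infty}}.$$
   Context: For $|q|<1$: $(a;q)_\infty=\prod_{k\ge0}(1-aq^k)$; for integers $n\ge0$, $(a;q)_n=\prod_{k=0}^{n-1}(1-aq^k)$; and $(a_1,\dots,a_m;q)_\infty=\prod_{k=1}^m(a_k;q)_\infty$. *)

theory Defs
  imports "HOL-Analysis.Analysis"
begin

definition qpoch :: "complex \<Rightarrow> complex \<Rightarrow> nat \<Rightarrow> complex" where
  "qpoch a q n = (\<Prod>k<n. 1 - a * q ^ k)"

(* Only meaningful for norm q < 1, where the product converges; factors may vanish. *)
definition qpoch_inf :: "complex \<Rightarrow> complex \<Rightarrow> complex" where
  "qpoch_inf a q = (\<Prod>k. 1 - a * q ^ k)"

definition qpochs_inf :: "complex list \<Rightarrow> complex \<Rightarrow> complex" where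
  "qpochs_inf as q = (\<Prod>a\<leftarrow>as. qpoch_inf a q)"

end

theory Submission
  imports Defs
begin

text \<open>
  With \<open>n = i + j\<close> the exponents become \<open>n\<^sup>2 + s n + j\<^sup>2 + s j\<close> up to a factor depending on \<open>j\<close> alone,
  where \<open>s\<close> is 0 or 1, so each double sum is an instance of Bailey's lemma applied twice. The Bailey
  pairs needed are identities such as
  \<open>\<Sum>t. q\<^bsup>6t\<^sup>2+t\<^esup> [2j, j - 3t] - q\<^bsup>6t\<^sup>2+5t+1\<^esup> [2j, j - 3t - 1] = 1\<close> for Gaussian binomials \<open>[n, k]\<close>. They
  follow by induction from the two Pascal rules, because the error terms cancel under the reflection
  \<open>k \<mapsto> n - k\<close>. Bailey's lemma turns each double sum into a difference of two theta series with
  quadratic term \<open>24t\<^sup>2\<close>, which the quintuple product identity evaluates.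
\<close>

section \<open>Dominated convergence and absolutely convergent sums over the integers\<close>

text \<open>The number s is the exponent in the Bailey parameter a = q^s: s = 0 brings the
  denominators (q;q)_{2j}, s = 1 brings (q;q)_{2j+1}. In the fifth and sixth sums the exponent
  belongs to the other denominator; there the pair carries a factor 1 - q^(2j+1) or 1 - q^(2j),
  which lowers the index of the denominator by one. Among the binomial identities only case
  \<open>A\<close> needs an induction; \<open>B\<close> follows from \<open>A\<close> by one Pascal
  step, and \<open>C\<close> and \<open>D\<close> follow from \<open>A\<close> and \<open>B\<close>.
  Each pass of Bailey's lemma multiplies the term of index r by q^(r^2 + s r). With r = 3t + d, two
  passes add 18 t^2 to the original 6 t^2, hence 24 t^2. The quintuple product is taken with p = q^8
  and z = q^c, where c = 3, 5, 2, 6, 1, 7 in the order of the statement. Reciprocal Pochhammer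
  symbols vanish at negative indices and r, t run over all integers, so boundary terms take care of
  themselves. Negative powers of q then occur, and q = 0 is settled separately.\<close>

lemma infsum_dominated_convergence:
  fixes f :: "nat \<Rightarrow> 'a \<Rightarrow> 'b::banach"
  assumes lim: "\<And>x. x \<in> A \<Longrightarrow> (\<lambda>n. f n x) \<longlonglongrightarrow> g x"
    and bound: "\<And>n x. x \<in> A \<Longrightarrow> norm (f n x) \<le> h x"
    and h: "h summable_on A"
  shows "(\<lambda>n. infsum (f n) A) \<longlonglongrightarrow> infsum g A"
proof -
  have h_nonneg: "0 \<le> h x" if "x \<in> A" for x
    using bound[OF that, of 0] norm_ge_zero order_trans by blast
  have gb: "norm (g x) \<le> h x" if "x \<in> A" for x
    by (rule Lim_bounded[OF tendsto_norm[OF lim[OF that]]]) (use bound[OF that] in auto)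
  have summ: "u summable_on B" "norm (infsum u B) \<le> infsum h B"
    if "B \<subseteq> A" "\<And>x. x \<in> A \<Longrightarrow> norm (u x) \<le> h x" for u :: "'a \<Rightarrow> 'b" and B
  proof -
    have hB: "h summable_on B" by (rule summable_on_subset_banach[OF h that(1)])
    have n: "(\<lambda>x. norm (u x)) summable_on B"
      by (rule summable_on_comparison_test[OF hB]) (use that in auto)
    show "u summable_on B" by (rule abs_summable_summable[OF n])
    show "norm (infsum u B) \<le> infsum h B"
      by (rule norm_infsum_le[OF has_sum_infsum has_sum_infsum])
         (use abs_summable_summable[OF n] hB that in auto)
  qed
  show ?thesis
  proof (rule LIMSEQ_I)
    fix e :: real assume "e > 0"
    \<comment> \<open>As in Tannery's theorem: outside \<open>F\<close> the majorant sums to at most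
      e/4, which bounds both tails, and on the finite set \<open>F\<close> the limit passes
      termwise.\<close>
    obtain F where F: "finite F" "F \<subseteq> A" "dist (sum h F) (infsum h A) \<le> e / 4"
      using infsum_finite_approximation[OF h, of "e/4"] \<open>e > 0\<close> by auto
    have split: "infsum u A = sum u F + infsum u (A - F)" if "u summable_on A" for u :: "'a \<Rightarrow> 'c::banach"
    proof -
      have "infsum u (F \<union> (A - F)) = infsum u F + infsum u (A - F)"
        by (rule infsum_Un_disjoint) (use F that summable_on_subset_banach[OF that] in auto)
      then show ?thesis using F by (simp add: Un_absorb1)
    qed
    have tail: "infsum h (A - F) \<le> e / 4"
      using split[OF h] F(3) by (auto simp: dist_norm)
    have "(\<lambda>n. sum (f n) F) \<longlonglongrightarrow> sum g F"
      by (intro tendsto_sum lim) (use F in auto)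
    then obtain N where N: "\<And>n. n \<ge> N \<Longrightarrow> norm (sum (f n) F - sum g F) < e / 4"
      using \<open>e > 0\<close> by (metis LIMSEQ_D divide_pos_pos zero_less_numeral)
    have "norm (infsum (f n) A - infsum g A) < e" if "n \<ge> N" for n
    proof -
      have "infsum (f n) A - infsum g A
          = (sum (f n) F - sum g F) + infsum (f n) (A - F) - infsum g (A - F)"
        using split[of "f n"] split[of g] summ(1)[of A "f n"] summ(1)[of A g] gb bound
        by simp
      also have "norm \<dots> \<le> norm (sum (f n) F - sum g F) + norm (infsum (f n) (A - F)) + norm (infsum g (A - F))"
        by (meson norm_triangle_ineq norm_triangle_ineq4 add_right_mono order_trans)
      also have "\<dots> < e / 4 + e / 4 + e / 4"
        using N[OF that] summ(2)[of "A - F" "f n"] summ(2)[of "A - F" g] gb bound tail by force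
      also have "\<dots> \<le> e" using \<open>e > 0\<close> by simp
      finally show ?thesis .
    qed
    then show "\<exists>N. \<forall>n\<ge>N. norm (infsum (f n) A - infsum g A) < e" by blast
  qed
qed

lemma summable_on_geometric_int:
  fixes x :: real
  assumes "0 \<le> x" "x < 1"
  shows "(\<lambda>t::int. x ^ nat \<bar>t\<bar>) summable_on UNIV"
proof -
  have s: "(\<lambda>n. x ^ n) summable_on (UNIV :: nat set)"
    using assms by (subst summable_on_UNIV_nonneg_real_iff) (auto intro: summable_geometric)
  have "(\<lambda>t::int. x ^ nat \<bar>t\<bar>) summable_on range int"
    by (subst summable_on_reindex) (auto simp: o_def s)
  moreover have "(\<lambda>t::int. x ^ nat \<bar>t\<bar>) summable_on range (\<lambda>n. - int n)"
    by (subst summable_on_reindex) (auto simp: o_def s inj_on_def)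
  ultimately have "(\<lambda>t::int. x ^ nat \<bar>t\<bar>) summable_on (range int \<union> range (\<lambda>n. - int n))"
    by (rule summable_on_union)
  moreover have "t \<in> range int \<union> range (\<lambda>n. - int n)" for t :: int
    by (cases t rule: int_cases2) auto
  then have "range int \<union> range (\<lambda>n. - int n) = UNIV" by blast
  ultimately show ?thesis by simp
qed

lemma summable_on_quadratic_powr:
  fixes x a b :: real
  assumes "0 < x" "x < 1" "a > 0"
  shows "(\<lambda>t::int. x powr (a * of_int t ^ 2 + b * of_int t)) summable_on UNIV"
proof -
  \<comment> \<open>The extra 1 in \<open>M\<close> leaves a linear gain: completing the square
    gives a t^2 + b t >= |t| - M^2/(4a), so a geometric series in |t| dominates.\<close>
  define M where "M = \<bar>b\<bar> + 1"
  have "norm (x powr (a * of_int t ^ 2 + b * of_int t)) \<le> x powr (- (M^2 / (4*a))) * x ^ nat \<bar>t\<bar>" for t :: int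
  proof -
    have eq: "(2 * a * T - M)^2 = 4 * a * (a * T^2 - M * T) + M^2" for T
      by (simp add: power2_eq_square algebra_simps)
    have "0 \<le> (2 * a * \<bar>of_int t\<bar> - M)^2 / (4*a)" using assms by simp
    also have "\<dots> = a * of_int t ^ 2 - M * \<bar>of_int t\<bar> + M^2 / (4*a)"
      using assms by (simp add: eq add_divide_distrib)
    finally have "\<bar>of_int t\<bar> - M^2/(4*a) \<le> a * of_int t ^ 2 - \<bar>b\<bar> * \<bar>of_int t\<bar>"
      by (simp add: M_def algebra_simps)
    moreover have "- (\<bar>b\<bar> * \<bar>of_int t\<bar>) \<le> b * of_int t"
      using abs_ge_minus_self[of "b * of_int t"] by (simp add: abs_mult)
    ultimately have "- (M^2/(4*a)) + \<bar>of_int t\<bar> \<le> a * of_int t ^ 2 + b * of_int t" by linarith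
    then have "x powr (a * of_int t ^ 2 + b * of_int t) \<le> x powr (- (M^2/(4*a)) + \<bar>of_int t\<bar>)"
      using assms by (simp add: powr_mono')
    also have "\<dots> = x powr (- (M^2 / (4*a))) * x powr real (nat \<bar>t\<bar>)"
      by (subst powr_add) simp
    also have "x powr real (nat \<bar>t\<bar>) = x ^ nat \<bar>t\<bar>"
      using assms(1) by (rule powr_realpow)
    finally show ?thesis by simp
  qed
  then have le: "x powr (a * of_int t ^ 2 + b * of_int t) \<le> x powr (- (M^2 / (4*a))) * x ^ nat \<bar>t\<bar>" for t :: int
    by simp
  have "(\<lambda>t::int. x powr (- (M^2 / (4*a))) * x ^ nat \<bar>t\<bar>) summable_on UNIV"
    using assms by (intro summable_on_cmult_right summable_on_geometric_int) auto
  then show ?thesis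
    by (rule summable_on_comparison_test) (use le in auto)
qed

lemma summable_on_quadratic_power_int:
  fixes q :: complex
  assumes "q \<noteq> 0" "norm q < 1" "a > 0"
  shows "(\<lambda>t::int. norm (q powi (a * t ^ 2 + b * t))) summable_on UNIV"
proof -
  have "norm (q powi (a * t ^ 2 + b * t)) = norm q powr (of_int a * of_int t ^ 2 + of_int b * of_int t)" for t
    using assms by (simp add: norm_power_int powr_real_of_int' flip: of_int_mult of_int_add of_int_power)
  then show ?thesis
    using summable_on_quadratic_powr[of "norm q" "of_int a" "of_int b"] assms by simp
qed

lemma infsum_reflect_int: "(\<Sum>\<^sub>\<infinity>t::int. f (c - t)) = (\<Sum>\<^sub>\<infinity>t. f t)"
  by (rule infsum_reindex_bij_witness[of _ "\<lambda>t. c - t" "\<lambda>t. c - t"]) auto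

lemma infsum_shift_int: "(\<Sum>\<^sub>\<infinity>t::int. f (t + c)) = (\<Sum>\<^sub>\<infinity>t. f t)"
  by (rule infsum_reindex_bij_witness[of _ "\<lambda>t. t - c" "\<lambda>t. t + c"]) auto

section \<open>Pochhammer symbols and Gaussian binomials\<close>

lemma qpoch_Suc: "qpoch a q (Suc n) = qpoch a q n * (1 - a * q ^ n)"
  by (simp add: qpoch_def)

lemma convergent_prod_qpoch:
  fixes a q :: complex
  assumes "norm q < 1"
  shows "convergent_prod (\<lambda>k. 1 - a * q ^ k)"
proof -
  have "summable (\<lambda>k. norm (1 - a * q ^ k - 1))"
    using assms summable_mult[OF summable_geometric[of "norm q"], of "norm a"]
    by (simp add: norm_mult norm_power)
  then show ?thesis
    by (intro abs_convergent_prod_imp_convergent_prod summable_imp_abs_convergent_prod)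
qed

lemma qpoch_tendsto:
  assumes "norm q < 1"
  shows "(\<lambda>n. qpoch a q n) \<longlonglongrightarrow> qpoch_inf a q"
  unfolding qpoch_def qpoch_inf_def
  using convergent_prod_LIMSEQ[OF convergent_prod_qpoch[OF assms, of a]]
  by (subst LIMSEQ_lessThan_iff_atMost)

lemma qpoch_nonzero:
  assumes "norm q < 1"
  shows "qpoch q q n \<noteq> 0"
  unfolding qpoch_def using assms power_eq_1_iff[of q "Suc _"] by auto

lemma qpoch_inf_nonzero:
  assumes "norm q < 1"
  shows "qpoch_inf q q \<noteq> 0"
  unfolding qpoch_inf_def using assms power_eq_1_iff[of q "Suc _"]
  by (intro prodinf_nonzero convergent_prod_qpoch) auto

text \<open>Extended by zero to negative indices, so that all sums can run over the integers.\<close>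

definition rqpoch :: "complex \<Rightarrow> int \<Rightarrow> complex" where
  "rqpoch q k = (if k < 0 then 0 else inverse (qpoch q q (nat k)))"

definition qbinom :: "complex \<Rightarrow> nat \<Rightarrow> int \<Rightarrow> complex" where
  "qbinom q n k = qpoch q q n * rqpoch q k * rqpoch q (int n - k)"

lemma rqpoch_tendsto:
  assumes "norm q < 1"
  shows "(\<lambda>n. rqpoch q (int n + c)) \<longlonglongrightarrow> inverse (qpoch_inf q q)"
proof -
  have "filterlim (\<lambda>n. nat (int n + c)) sequentially sequentially"
    by (rule filterlim_at_top_mono[OF filterlim_minus_const_nat_at_top[of "nat \<bar>c\<bar>"]]) (auto intro!: always_eventually)
  then have "(\<lambda>n. inverse (qpoch q q (nat (int n + c)))) \<longlonglongrightarrow> inverse (qpoch_inf q q)"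
    by (intro tendsto_inverse filterlim_compose[OF qpoch_tendsto[OF assms]] qpoch_inf_nonzero assms)
  moreover have "eventually (\<lambda>n. inverse (qpoch q q (nat (int n + c))) = rqpoch q (int n + c)) sequentially"
    using eventually_ge_at_top[of "nat \<bar>c\<bar>"] by eventually_elim (auto simp: rqpoch_def)
  ultimately show ?thesis by (rule Lim_transform_eventually)
qed

lemma qpoch_bounded:
  assumes "norm q < 1"
  obtains C where "C > 0" "\<And>n. norm (qpoch q q n) \<le> C"
  using convergent_imp_Bseq[OF convergentI[OF qpoch_tendsto[OF assms, of q]]]
  unfolding Bseq_def by auto

lemma rqpoch_bounded:
  assumes "norm q < 1"
  obtains C where "C > 0" "\<And>k. norm (rqpoch q k) \<le> C"
proof -
  have "Bseq (\<lambda>n. rqpoch q (int n))"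
    using rqpoch_tendsto[OF assms, of 0] by (auto intro: convergent_imp_Bseq convergentI)
  then obtain C where C: "C > 0" "\<And>n. norm (rqpoch q (int n)) \<le> C" unfolding Bseq_def by auto
  have "norm (rqpoch q k) \<le> C" for k
    using C(1) C(2)[of "nat k"] by (cases "k < 0") (auto simp: rqpoch_def)
  with C(1) show ?thesis using that by blast
qed

text \<open>The extension by zero keeps the recurrence valid for every integer: at k = 0 the factor
  1 - q^0 matches the vanishing value at -1. Pascal's rules therefore need no boundary
  cases.\<close>

lemma rqpoch_rec:
  assumes "norm q < 1" "q \<noteq> 0"
  shows "(1 - q powi k) * rqpoch q k = rqpoch q (k - 1)"
proof -
  consider "k < 0" | "k = 0" | n where "k = int (Suc n)"
    by (metis int_cases3 not_gr_zero of_nat_0 Suc_pred neg_less_0_iff_less of_nat_0_less_iff)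
  then show ?thesis
  proof cases
    case (3 n)
    have "qpoch q q (Suc n) \<noteq> 0" using qpoch_nonzero assms by blast
    moreover have "nat (1 + int n) = Suc n" by simp
    ultimately show ?thesis using 3
      by (simp add: rqpoch_def qpoch_Suc power_int_def field_simps)
  qed (auto simp: rqpoch_def)
qed

lemma qbinom_neg: "k < 0 \<Longrightarrow> qbinom q n k = 0"
  and qbinom_gt: "k > int n \<Longrightarrow> qbinom q n k = 0"
  by (auto simp: qbinom_def rqpoch_def)

lemma qbinom_symmetric: "qbinom q n (int n - k) = qbinom q n k"
  by (simp add: qbinom_def)

text \<open>Split 1 - q^(n+1) = (1 - q^k) + q^k (1 - q^(n+1-k)); by \<open>rqpoch_rec\<close> each
  bracket lowers one of the two denominators.\<close>

lemma qbinom_Suc: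
  assumes "norm q < 1" "q \<noteq> 0"
  shows "qbinom q (Suc n) k = qbinom q n (k - 1) + q powi k * qbinom q n k"
proof -
  let ?m = "int (Suc n) - k"
  have "qpoch q q (Suc n) = qpoch q q n * (1 - q powi (int (Suc n)))"
    by (simp add: qpoch_Suc power_int_def nat_add_distrib)
  also have "q powi (int (Suc n)) = q powi k * q powi ?m"
    using assms by (simp flip: power_int_add)
  finally have qS: "qpoch q q (Suc n) = qpoch q q n * (1 - q powi k * q powi ?m)" .
  have "qbinom q (Suc n) k = qpoch q q n * ((1 - q powi k) + q powi k * (1 - q powi ?m))
      * rqpoch q k * rqpoch q ?m"
    unfolding qbinom_def qS by (simp add: algebra_simps del: of_nat_Suc)
  also have "\<dots> = qpoch q q n * ((1 - q powi k) * rqpoch q k) * rqpoch q ?m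
      + q powi k * (qpoch q q n * rqpoch q k * ((1 - q powi ?m) * rqpoch q ?m))"
    by (simp add: algebra_simps)
  finally show ?thesis
    unfolding rqpoch_rec[OF assms] by (simp add: qbinom_def algebra_simps)
qed

lemma qbinom_Suc':
  assumes "norm q < 1" "q \<noteq> 0"
  shows "qbinom q (Suc n) k = qbinom q n k + q powi (int (Suc n) - k) * qbinom q n (k - 1)"
  using qbinom_Suc[OF assms, of n "int (Suc n) - k"] qbinom_symmetric[of q "Suc n" k]
    qbinom_symmetric[of q n k] qbinom_symmetric[of q n "k - 1"]
  by (simp add: algebra_simps)

lemma qbinom_0: "qbinom q 0 k = (if k = 0 then 1 else 0)"
  by (auto simp: qbinom_def rqpoch_def qpoch_def)

lemma qbinom_tendsto:
  assumes "norm q < 1"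
  shows "(\<lambda>n. qbinom q (2*n) (int n - r)) \<longlonglongrightarrow> inverse (qpoch_inf q q)"
proof -
  have "(\<lambda>n. qpoch q q (2*n) * rqpoch q (int n + (-r)) * rqpoch q (int n + r))
      \<longlonglongrightarrow> qpoch_inf q q * inverse (qpoch_inf q q) * inverse (qpoch_inf q q)"
    by (intro tendsto_mult rqpoch_tendsto assms
        filterlim_compose[OF qpoch_tendsto[OF assms]] mult_nat_left_at_top) auto
  then show ?thesis
    using qpoch_inf_nonzero[OF assms] by (simp add: qbinom_def algebra_simps)
qed

lemma qbinom_bounded:
  assumes "norm q < 1"
  obtains C where "C > 0" "\<And>n k. norm (qbinom q n k) \<le> C"
proof -
  obtain B where B: "B > 0" "\<And>n. norm (qpoch q q n) \<le> B" using qpoch_bounded[OF assms] by blast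
  obtain C where C: "C > 0" "\<And>k. norm (rqpoch q k) \<le> C" using rqpoch_bounded[OF assms] by blast
  have "norm (qbinom q n k) \<le> B * C * C" for n k
    unfolding qbinom_def norm_mult using B C by (intro mult_mono) (auto intro: less_imp_le)
  then show ?thesis using that[of "B*C*C"] B(1) C(1) by simp
qed

section \<open>Polynomial identities for the Bailey pairs\<close>

text \<open>Keeping the offset \<open>c\<close> and the linear coefficient \<open>b\<close> as
  parameters makes reflection, shift and both Pascal rules act on the pair (c, b) alone, up to a
  power of q.\<close>

definition tsum :: "complex \<Rightarrow> nat \<Rightarrow> int \<Rightarrow> int \<Rightarrow> complex" where
  "tsum q n c b = (\<Sum>\<^sub>\<infinity>t. q powi (6 * t\<^sup>2 + b * t) * qbinom q n (c - 3 * t))"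

lemma tsum_summable:
  fixes g :: "int \<Rightarrow> complex"
  shows "(\<lambda>t::int. g t * qbinom q n (c - 3 * t)) summable_on A"
proof (rule finite_nonzero_values_imp_summable_on, rule finite_subset)
  show "{t \<in> A. g t * qbinom q n (c - 3 * t) \<noteq> 0} \<subseteq> {-(\<bar>c\<bar> + int n)..\<bar>c\<bar> + int n}"
  proof
    fix t assume "t \<in> {t \<in> A. g t * qbinom q n (c - 3 * t) \<noteq> 0}"
    then have "\<not> c - 3 * t < 0" "\<not> c - 3 * t > int n"
      using qbinom_neg qbinom_gt by fastforce+
    then show "t \<in> {-(\<bar>c\<bar> + int n)..\<bar>c\<bar> + int n}" by auto
  qed
qed simp

lemma tsum_reflect: "tsum q n c b = tsum q n (int n - c) (- b)"
proof -
  have "tsum q n (int n - c) (- b) = (\<Sum>\<^sub>\<infinity>t. q powi (6 * (0 - t)\<^sup>2 + - b * (0 - t)) * qbinom q n (int n - c - 3 * (0 - t)))"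
    unfolding tsum_def by (rule infsum_reflect_int[symmetric])
  also have "\<dots> = tsum q n c b"
    unfolding tsum_def
    by (intro infsum_cong) (use qbinom_symmetric[of q n "c - 3 * _"] in \<open>simp add: algebra_simps\<close>)
  finally show ?thesis by simp
qed

context
  fixes q :: complex
  assumes q: "norm q < 1" "q \<noteq> 0"
begin

lemma tsum_shift: "tsum q n c b = q powi (6 - b) * tsum q n (c + 3) (b - 12)"
proof -
  have e: "q powi (6 * (t + -1)\<^sup>2 + b * (t + -1)) = q powi (6 - b) * q powi (6 * t\<^sup>2 + (b - 12) * t)" for t
    using q by (simp add: algebra_simps power2_eq_square flip: power_int_add)
  have "tsum q n c b = (\<Sum>\<^sub>\<infinity>t. q powi (6 * (t + -1)\<^sup>2 + b * (t + -1)) * qbinom q n (c - 3 * (t + -1)))"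
    unfolding tsum_def by (rule infsum_shift_int[symmetric])
  also have "\<dots> = (\<Sum>\<^sub>\<infinity>t. q powi (6 - b) * (q powi (6 * t\<^sup>2 + (b - 12) * t) * qbinom q n (c + 3 - 3 * t)))"
    unfolding e by (simp add: algebra_simps)
  finally show ?thesis
    by (simp add: tsum_def infsum_cmult_right')
qed

text \<open>The factor q^(c - 3t) of Pascal's rule splits into a constant q^c and a change of the
  linear coefficient by -3.\<close>

lemma tsum_Suc: "tsum q (Suc n) c b = tsum q n (c - 1) b + q powi c * tsum q n c (b - 3)"
proof -
  have e: "q powi (6 * t\<^sup>2 + b * t) * q powi (c - 3 * t) = q powi c * q powi (6 * t\<^sup>2 + (b - 3) * t)" for t
    using q by (simp add: algebra_simps flip: power_int_add)
  have "q powi (6 * t\<^sup>2 + b * t) * qbinom q (Suc n) (c - 3 * t)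
      = q powi (6 * t\<^sup>2 + b * t) * qbinom q n (c - 1 - 3 * t)
      + q powi c * (q powi (6 * t\<^sup>2 + (b - 3) * t) * qbinom q n (c - 3 * t))" for t
    unfolding qbinom_Suc[OF q] distrib_left mult.assoc[symmetric] e by (simp add: algebra_simps)
  then have "tsum q (Suc n) c b = (\<Sum>\<^sub>\<infinity>t. q powi (6 * t\<^sup>2 + b * t) * qbinom q n (c - 1 - 3 * t)
      + q powi c * (q powi (6 * t\<^sup>2 + (b - 3) * t) * qbinom q n (c - 3 * t)))"
    unfolding tsum_def by presburger
  also have "\<dots> = tsum q n (c - 1) b + q powi c * tsum q n c (b - 3)"
    unfolding tsum_def
    by (subst infsum_add) (auto intro: tsum_summable summable_on_cmult_right simp: infsum_cmult_right')
  finally show ?thesis .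
qed

lemma tsum_Suc': "tsum q (Suc n) c b = tsum q n c b + q powi (int n + 1 - c) * tsum q n (c - 1) (b + 3)"
proof -
  have "tsum q (Suc n) c b = tsum q (Suc n) (int n + 1 - c) (- b)"
    by (subst tsum_reflect) (simp add: algebra_simps)
  also have "\<dots> = tsum q n (int n - c) (- b) + q powi (int n + 1 - c) * tsum q n (int n - (c - 1)) (- (b + 3))"
    by (subst tsum_Suc) (simp add: algebra_simps)
  finally show ?thesis
    using tsum_reflect[of q n c b] tsum_reflect[of q n "c - 1" "b + 3"] by simp
qed

lemma tsum_0: "c = 0 \<or> c = -1 \<Longrightarrow> tsum q 0 c b = (if c = 0 then 1 else 0)"
proof -
  assume c: "c = 0 \<or> c = -1"
  \<comment> \<open>For these two offsets no t other than 0 can make c - 3t vanish, so a single term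
    survives in row 0.\<close>
  then have nz: "c - 3 * t \<noteq> 0" if "t \<noteq> 0" for t using that by presburger
  have "tsum q 0 c b = (\<Sum>\<^sub>\<infinity>t\<in>{0}. q powi (6 * t\<^sup>2 + b * t) * qbinom q 0 (c - 3 * t))"
    unfolding tsum_def by (rule infsum_cong_neutral) (use nz in \<open>auto simp: qbinom_0\<close>)
  then show ?thesis using c by (auto simp: qbinom_0)
qed

text \<open>Reflection sends the left side to offset j + 1 and coefficient -4, and the shift t to t
  - 1 sends the right side to the same place.\<close>

lemma tsum_cancel_even:
  "tsum q (2 * j) (int j - 1) 4 = q ^ 2 * tsum q (2 * j) (int j - 2) 8"
  using tsum_reflect[of q "2 * j" "int j - 1" 4] tsum_shift[of "2 * j" "int j - 2" 8] q
  by (simp add: field_simps power_int_minus power2_eq_square)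

lemma tsum_cancel_odd: 
  "tsum q (2 * j + 1) (int j + 1) (-2) = tsum q (2 * j + 1) (int j) 2"
  using tsum_reflect[of q "2 * j + 1" "int j" 2] by (simp add: algebra_simps)

lemma power_int_of_nat_plus: "q powi (int n + numeral k) = q ^ (n + numeral k)" "q powi (int n + 1) = q ^ (n + 1)"
  by (simp_all add: power_int_def nat_add_distrib)

text \<open>Dividing by \<open>(q; q)\<^bsub>2j\<^esub>\<close> or \<open>(q; q)\<^bsub>2j+1\<^esub>\<close> turns cases \<open>A\<close> and \<open>B\<close> into Bailey pairs of Slater's group A.\<close>

lemma tsum_A_odd_step:
  "tsum q (2 * j + 1) (int j) 1 - q * tsum q (2 * j + 1) (int j - 1) 5
    = tsum q (2 * j) (int j) 1 - q * tsum q (2 * j) (int j - 1) 5"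
proof -
  have 1: "tsum q (2 * j + 1) (int j) 1 = tsum q (2 * j) (int j) 1 + q ^ (j + 1) * tsum q (2 * j) (int j - 1) 4"
    using tsum_Suc'[of "2 * j" "int j" 1] by (simp add: power_int_of_nat_plus)
  have 2: "tsum q (2 * j + 1) (int j - 1) 5 = tsum q (2 * j) (int j - 1) 5 + q ^ (j + 2) * tsum q (2 * j) (int j - 2) 8"
    using tsum_Suc'[of "2 * j" "int j - 1" 5] by (simp add: power_int_of_nat_plus)
  show ?thesis unfolding 1 2 tsum_cancel_even by (simp add: algebra_simps power2_eq_square)
qed

text \<open>The Pascal rule opposite to that of the odd step is needed here: its main terms stay at
  offsets j and j - 1, and its error terms are reflections of each other by
  \<open>tsum_cancel_odd\<close>.\<close>

lemma tsum_A_even_step: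
  "tsum q (2 * j + 2) (int j + 1) 1 - q * tsum q (2 * j + 2) (int j) 5
    = tsum q (2 * j + 1) (int j) 1 - q * tsum q (2 * j + 1) (int j - 1) 5"
proof -
  have 1: "tsum q (2 * j + 2) (int j + 1) 1
      = tsum q (2 * j + 1) (int j) 1 + q ^ (j + 1) * tsum q (2 * j + 1) (int j + 1) (-2)"
    using tsum_Suc[of "2 * j + 1" "int j + 1" 1] by (simp add: power_int_of_nat_plus)
  have 2: "tsum q (2 * j + 2) (int j) 5 = tsum q (2 * j + 1) (int j - 1) 5 + q ^ j * tsum q (2 * j + 1) (int j) 2"
    using tsum_Suc[of "2 * j + 1" "int j" 5] by simp
  show ?thesis unfolding 1 2 tsum_cancel_odd by (simp add: algebra_simps)
qed

text \<open>The difference does not change from one row of the Pascal triangle to the next, so it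
  keeps its value from row 0.\<close>

lemma tsum_A_even: "tsum q (2 * j) (int j) 1 - q * tsum q (2 * j) (int j - 1) 5 = 1"
proof (induction j)
  case 0
  then show ?case by (simp add: tsum_0)
next
  case (Suc j)
  then show ?case using tsum_A_even_step[of j] tsum_A_odd_step[of j] by (simp add: algebra_simps)
qed

lemma tsum_A_odd: "tsum q (2 * j + 1) (int j) 1 - q * tsum q (2 * j + 1) (int j - 1) 5 = 1"
  using tsum_A_odd_step[of j] tsum_A_even[of j] by simp

text \<open>Here the roles are exchanged: after one Pascal step the main terms cancel by reflection,
  and the error terms form q^j times case \<open>A\<close> in the preceding odd row.\<close>

lemma tsum_B_even: "tsum q (2 * j) (int j) 2 - tsum q (2 * j) (int j - 1) 2 = q ^ j"
proof (cases j)
  case 0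
  then show ?thesis by (simp add: tsum_0)
next
  case (Suc i)
  have 1: "tsum q (2 * i + 2) (int i + 1) (-2)
      = tsum q (2 * i + 1) (int i + 1) (-2) + q ^ (i + 1) * tsum q (2 * i + 1) (int i) 1"
    using tsum_Suc'[of "2 * i + 1" "int i + 1" "-2"] by (simp add: power_int_of_nat_plus)
  have 2: "tsum q (2 * i + 2) (int i) 2
      = tsum q (2 * i + 1) (int i) 2 + q ^ (i + 2) * tsum q (2 * i + 1) (int i - 1) 5"
    using tsum_Suc'[of "2 * i + 1" "int i" 2] by (simp add: power_int_of_nat_plus)
  have 3: "tsum q (2 * i + 2) (int i + 1) 2 = tsum q (2 * i + 2) (int i + 1) (-2)"
    by (subst tsum_reflect) (simp add: algebra_simps)
  have "tsum q (2 * i + 2) (int i + 1) 2 - tsum q (2 * i + 2) (int i) 2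
      = q ^ (i + 1) * (tsum q (2 * i + 1) (int i) 1 - q * tsum q (2 * i + 1) (int i - 1) 5)"
    unfolding 1 2 3 tsum_cancel_odd by (simp add: algebra_simps)
  then show ?thesis unfolding tsum_A_odd using Suc by (simp add: algebra_simps)
qed

lemma tsum_B_odd: "tsum q (2 * j + 1) (int j) 4 - q ^ 2 * tsum q (2 * j + 1) (int j - 1) 8 = q ^ j"
proof -
  have 1: "tsum q (2 * j + 1) (int j) 4 = tsum q (2 * j) (int j - 1) 4 + q ^ j * tsum q (2 * j) (int j) 1"
    using tsum_Suc[of "2 * j" "int j" 4] by simp
  \<comment> \<open>The additional factor q avoids the exponent j - 1, which is negative for j =
    0.\<close>
  have 2: "q * tsum q (2 * j + 1) (int j - 1) 8
      = q * tsum q (2 * j) (int j - 2) 8 + q ^ j * tsum q (2 * j) (int j - 1) 5"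
    using tsum_Suc[of "2 * j" "int j - 1" 8] q by (simp add: power_int_diff field_simps)
  have "tsum q (2 * j + 1) (int j) 4 - q ^ 2 * tsum q (2 * j + 1) (int j - 1) 8
      = tsum q (2 * j + 1) (int j) 4 - q * (q * tsum q (2 * j + 1) (int j - 1) 8)"
    by (simp add: power2_eq_square)
  also have "\<dots> = q ^ j * (tsum q (2 * j) (int j) 1 - q * tsum q (2 * j) (int j - 1) 5)"
    unfolding 1 2 tsum_cancel_even by (simp add: algebra_simps power2_eq_square)
  finally show ?thesis unfolding tsum_A_even by simp
qed

text \<open>Using different Pascal rules for the two sums, the main terms give case \<open>A\<close>
  and the error terms give -q^(j+1) times case \<open>B\<close>, that is 1 - q^(j+1) q^j.\<close>

lemma tsum_C: "tsum q (2 * j + 1) (int j) (-1) - q * tsum q (2 * j + 1) (int j) 5 = 1 - q ^ (2 * j + 1)"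
proof -
  have 1: "tsum q (2 * j + 1) (int j) (-1) = tsum q (2 * j) (int j) (-1) + q ^ (j + 1) * tsum q (2 * j) (int j - 1) 2"
    using tsum_Suc'[of "2 * j" "int j" "-1"] by (simp add: power_int_of_nat_plus)
  have 2: "tsum q (2 * j + 1) (int j) 5 = tsum q (2 * j) (int j - 1) 5 + q ^ j * tsum q (2 * j) (int j) 2"
    using tsum_Suc[of "2 * j" "int j" 5] by simp
  have 3: "tsum q (2 * j) (int j) (-1) = tsum q (2 * j) (int j) 1"
    by (subst tsum_reflect) simp
  have "tsum q (2 * j + 1) (int j) (-1) - q * tsum q (2 * j + 1) (int j) 5
     = (tsum q (2 * j) (int j) 1 - q * tsum q (2 * j) (int j - 1) 5)
      - q ^ (j + 1) * (tsum q (2 * j) (int j) 2 - tsum q (2 * j) (int j - 1) 2)"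
    unfolding 1 2 3 by (simp add: algebra_simps)
  then show ?thesis
    unfolding tsum_A_even tsum_B_even by (simp add: mult_2 power_add)
qed

text \<open>The analogue of \<open>tsum_C\<close> one row later, from the odd cases of
  \<open>A\<close> and \<open>B\<close>. Reflection followed by a shift first brings the
  coefficients 7 and 4 to the 5 and 8 that occur there.\<close>

lemma tsum_D: "tsum q (2 * j) (int j - 1) 1 - q ^ 2 * tsum q (2 * j) (int j - 1) 7 = 1 - q ^ (2 * j)"
proof (cases j)
  case 0
  then show ?thesis by (simp add: tsum_0)
next
  case (Suc i)
  have 1: "tsum q (2 * i + 2) (int i) 1
      = tsum q (2 * i + 1) (int i) 1 + q ^ (i + 2) * tsum q (2 * i + 1) (int i - 1) 4"
    using tsum_Suc'[of "2 * i + 1" "int i" 1] by (simp add: power_int_of_nat_plus)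
  have 2: "tsum q (2 * i + 2) (int i) 7 = tsum q (2 * i + 1) (int i - 1) 7 + q ^ i * tsum q (2 * i + 1) (int i) 4"
    using tsum_Suc[of "2 * i + 1" "int i" 7] by simp
  have refl: "tsum q (2 * i + 1) (int i - 1) b = tsum q (2 * i + 1) (2 + int i) (- b)" for b
    by (subst tsum_reflect) (simp add: algebra_simps)
  have "tsum q (2 * i + 1) (int i - 1) 7 = q powi (- 1) * tsum q (2 * i + 1) (2 + int i) (- 5)"
    using tsum_shift[of "2 * i + 1" "int i - 1" 7] by simp
  then have 3: "q * tsum q (2 * i + 1) (int i - 1) 7 = tsum q (2 * i + 1) (int i - 1) 5"
    unfolding refl[of 5] using q by simp
  have "tsum q (2 * i + 1) (int i - 1) 8 = q powi (- 2) * tsum q (2 * i + 1) (2 + int i) (- 4)"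
    using tsum_shift[of "2 * i + 1" "int i - 1" 8] by simp
  then have 4: "tsum q (2 * i + 1) (int i - 1) 4 = q ^ 2 * tsum q (2 * i + 1) (int i - 1) 8"
    unfolding refl[of 4] using q by (simp add: power_int_minus)
  have "tsum q (2 * i + 2) (int i) 1 - q ^ 2 * tsum q (2 * i + 2) (int i) 7
     = (tsum q (2 * i + 1) (int i) 1 - q * (q * tsum q (2 * i + 1) (int i - 1) 7))
      - q ^ (i + 2) * (tsum q (2 * i + 1) (int i) 4 - tsum q (2 * i + 1) (int i - 1) 4)"
    unfolding 1 2 by (simp add: algebra_simps power2_eq_square)
  moreover have "q ^ (i + 2) * q ^ i = q ^ (2 * j)"
    unfolding power_add[symmetric] using Suc by (intro arg_cong[where f = "\<lambda>k. q ^ k"]) simp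
  ultimately show ?thesis
    unfolding 3 4 tsum_A_odd tsum_B_odd using Suc by (simp add: add.commute)
qed

end

section \<open>Bailey's lemma\<close>

lemma summable_on_product_nonneg:
  fixes u :: "'a \<Rightarrow> real" and v :: "'b \<Rightarrow> real"
  assumes "u summable_on A" "v summable_on B" "\<And>x. x \<in> A \<Longrightarrow> u x \<ge> 0" "\<And>y. y \<in> B \<Longrightarrow> v y \<ge> 0"
  shows "(\<lambda>(x, y). u x * v y) summable_on A \<times> B"
proof (rule summable_on_SigmaI)
  show "((\<lambda>y. case (x, y) of (x, y) \<Rightarrow> u x * v y) has_sum u x * infsum v B) B" for x
    using has_sum_cmult_right[OF has_sum_infsum[OF assms(2)], of "u x"] by simp
  show "(\<lambda>x. u x * infsum v B) summable_on A"
    by (rule summable_on_cmult_left[OF assms(1)])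
qed (use assms in auto)

lemma summable_on_norm_bound:
  fixes f :: "'a \<Rightarrow> 'b::banach"
  assumes "g summable_on A" "\<And>x. x \<in> A \<Longrightarrow> norm (f x) \<le> g x"
  shows "f summable_on A"
  by (rule abs_summable_summable, rule summable_on_comparison_test[OF assms(1)]) (use assms(2) in auto)

lemma has_sum_product:
  fixes f :: "'a \<Rightarrow> complex" and g :: "'b \<Rightarrow> complex"
  assumes "(\<lambda>x. norm (f x)) summable_on A" "(\<lambda>y. norm (g y)) summable_on B"
  shows "((\<lambda>(x, y). f x * g y) has_sum infsum f A * infsum g B) (A \<times> B)"
proof (rule has_sum_SigmaI)
  show "((\<lambda>y. case (x, y) of (x, y) \<Rightarrow> f x * g y) has_sum f x * infsum g B) B" for x
    using has_sum_cmult_right[OF has_sum_infsum[OF abs_summable_summable[OF assms(2)]], of "f x"] by simp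
  show "((\<lambda>x. f x * infsum g B) has_sum infsum f A * infsum g B) A"
    by (rule has_sum_cmult_left[OF has_sum_infsum[OF abs_summable_summable[OF assms(1)]]])
  show "(\<lambda>(x, y). f x * g y) summable_on A \<times> B"
    by (rule summable_on_norm_bound[OF summable_on_product_nonneg[OF assms]]) (auto simp: norm_mult)
qed

context
  fixes q :: complex
  assumes q: "norm q < 1" "q \<noteq> 0"
begin

section \<open>The q-Vandermonde sum and Bailey's lemma for a = q^s\<close>

lemma rqpoch_step: "rqpoch q (int (m + k)) = (1 - q ^ (m + k + 1)) * rqpoch q (int (m + k + 1))"
  using rqpoch_rec[OF q, of "int (m + k + 1)"] by (simp add: power_int_def nat_add_distrib)

text \<open>Pascal's rule splits the sum. Shifting m in one part and applying
  \<open>rqpoch_step\<close> in the other produces terms with q^(m+k+1) of opposite sign; what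
  remains is the case N with k + 1, so \<open>k\<close> must vary in the induction.\<close>

lemma q_Vandermonde_nat:
  "(\<Sum>m\<le>N. q ^ (m * (m + k)) * qbinom q N (int m) * rqpoch q (int (m + k))) = rqpoch q (int (N + k))"
proof (induction N arbitrary: k)
  case 0
  show ?case by (simp add: qbinom_0)
next
  case (Suc N)
  let ?b = "\<lambda>m. qbinom q N (int m)"
  have pow: "q ^ (Suc m * (Suc m + k)) = q ^ (m * (m + (k + 1)) + (m + k + 1))" for m
    by (rule arg_cong[where f = "\<lambda>e. q ^ e"]) (simp add: algebra_simps)
  have "(\<Sum>m\<le>Suc N. q ^ (m * (m + k)) * qbinom q (Suc N) (int m) * rqpoch q (int (m + k)))
      = (\<Sum>m\<le>Suc N. q ^ (m * (m + k)) * qbinom q N (int m - 1) * rqpoch q (int (m + k)))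
      + (\<Sum>m\<le>Suc N. q ^ (m * (m + (k + 1))) * ?b m * rqpoch q (int (m + k)))"
    unfolding sum.distrib[symmetric] qbinom_Suc[OF q]
    by (intro sum.cong) (auto simp: algebra_simps power_add)
  also have "(\<Sum>m\<le>Suc N. q ^ (m * (m + k)) * qbinom q N (int m - 1) * rqpoch q (int (m + k)))
      = (\<Sum>m\<le>N. q ^ (Suc m * (Suc m + k)) * ?b m * rqpoch q (int (Suc m + k)))"
    by (subst sum.atMost_Suc_shift) (simp add: qbinom_neg)
  also have "\<dots> = (\<Sum>m\<le>N. q ^ (m * (m + (k + 1))) * q ^ (m + k + 1) * ?b m * rqpoch q (int (m + (k + 1))))"
    unfolding pow by (simp add: power_add mult_ac)
  also have "(\<Sum>m\<le>Suc N. q ^ (m * (m + (k + 1))) * ?b m * rqpoch q (int (m + k)))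
      = (\<Sum>m\<le>N. q ^ (m * (m + (k + 1))) * ?b m * ((1 - q ^ (m + k + 1)) * rqpoch q (int (m + (k + 1)))))"
    unfolding rqpoch_step[of _ k] by (simp add: qbinom_gt)
  also have "(\<Sum>m\<le>N. q ^ (m * (m + (k + 1))) * q ^ (m + k + 1) * ?b m * rqpoch q (int (m + (k + 1))))
      + (\<Sum>m\<le>N. q ^ (m * (m + (k + 1))) * ?b m * ((1 - q ^ (m + k + 1)) * rqpoch q (int (m + (k + 1)))))
      = (\<Sum>m\<le>N. q ^ (m * (m + (k + 1))) * ?b m * rqpoch q (int (m + (k + 1))))"
    unfolding sum.distrib[symmetric] by (intro sum.cong) (auto simp: algebra_simps)
  also have "\<dots> = rqpoch q (int (Suc N + k))"
    unfolding Suc.IH by (simp add: algebra_simps)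
  finally show ?case .
qed

text \<open>Division by (q;q)_N gives a form that also holds, as 0 = 0, for negative N; Bailey's
  lemma uses it at N = n - r without comparing n and r.\<close>

lemma q_Vandermonde:
  "((\<lambda>m. q ^ (m * (m + k)) * rqpoch q (N - int m) * rqpoch q (int m) * rqpoch q (int (m + k)))
     has_sum rqpoch q N * rqpoch q (N + int k)) UNIV"
proof (cases "N < 0")
  case True
  then show ?thesis by (auto simp: rqpoch_def)
next
  case False
  then obtain n where n: "N = int n" by (metis int_nat_eq not_less)
  have nz: "qpoch q q n \<noteq> 0" using qpoch_nonzero q by blast
  have rn: "rqpoch q N * qpoch q q n = 1" using nz by (simp add: n rqpoch_def)
  have "rqpoch q N * rqpoch q (N + int k)
     = (\<Sum>m\<le>n. rqpoch q N * (q ^ (m * (m + k)) * qbinom q n (int m) * rqpoch q (int (m + k))))"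
    using q_Vandermonde_nat[of k n] by (simp add: n flip: sum_distrib_left)
  also have "\<dots> = (\<Sum>m\<le>n. (rqpoch q N * qpoch q q n) * (q ^ (m * (m + k)) * rqpoch q (N - int m) * rqpoch q (int m) * rqpoch q (int (m + k))))"
    by (intro sum.cong) (auto simp: n qbinom_def)
  also have "\<dots> = (\<Sum>m\<le>n. q ^ (m * (m + k)) * rqpoch q (N - int m) * rqpoch q (int m) * rqpoch q (int (m + k)))"
    unfolding rn by simp
  finally show ?thesis
    by (intro has_sum_finite_neutralI[of "{..n}"]) (auto simp: n rqpoch_def)
qed

lemma summable_on_norm_power: "(\<lambda>n::nat. norm q ^ n) summable_on UNIV"
  using q by (subst summable_on_UNIV_nonneg_real_iff) (auto intro: summable_geometric)

text \<open>The limit of q-Vandermonde as N tends to infinity, after cancelling one factor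
  1/(q;q)_inf. For k = 0 this is the Durfee square identity.\<close>

lemma Durfee:
  "((\<lambda>m. q ^ (m * (m + k)) * rqpoch q (int m) * rqpoch q (int (m + k))) has_sum inverse (qpoch_inf q q)) UNIV"
proof -
  let ?g = "\<lambda>m. q ^ (m * (m + k)) * rqpoch q (int m) * rqpoch q (int (m + k))"
  let ?i = "inverse (qpoch_inf q q)"
  obtain C where C: "C > 0" "\<And>k. norm (rqpoch q k) \<le> C" using rqpoch_bounded q by blast
  have pw: "norm q ^ (m * (m + k)) \<le> norm q ^ m" for m
    using q by (intro power_decreasing) (auto simp: add_mult_distrib2 intro: order_trans[OF _ le_add1])
  have C2: "norm (rqpoch q a * rqpoch q b) \<le> C * C" for a b
    unfolding norm_mult using C by (intro mult_mono) (auto intro: less_imp_le)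
  have b2: "norm (?g m) \<le> C * C * norm q ^ m" for m
    using mult_mono[OF pw C2[of "int m" "int (m + k)"]] by (simp add: norm_mult norm_power mult_ac)
  have s2: "(\<lambda>m. C * C * norm q ^ m) summable_on UNIV"
    by (intro summable_on_cmult_right summable_on_norm_power)
  have sg: "?g summable_on UNIV" by (rule summable_on_norm_bound[OF s2 b2])
  have "(\<lambda>N. infsum (\<lambda>m. ?g m * rqpoch q (int N + - int m)) UNIV) \<longlonglongrightarrow> infsum (\<lambda>m. ?g m * ?i) UNIV"
  proof (rule infsum_dominated_convergence)
    show "(\<lambda>N. ?g m * rqpoch q (int N + - int m)) \<longlonglongrightarrow> ?g m * ?i" for m
      by (intro tendsto_mult tendsto_const rqpoch_tendsto q)
    show "norm (?g m * rqpoch q (int N + - int m)) \<le> C * C * norm q ^ m * C" for m N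
      unfolding norm_mult[of "?g m"] using b2[of m] C by (intro mult_mono) auto
    show "(\<lambda>m. C * C * norm q ^ m * C) summable_on UNIV"
      by (rule summable_on_cmult_left[OF s2])
  qed
  moreover have "infsum (\<lambda>m. ?g m * rqpoch q (int N + - int m)) UNIV = rqpoch q (int N + 0) * rqpoch q (int N + int k)" for N
    using infsumI[OF q_Vandermonde[of k "int N"]] by (simp add: mult_ac)
  moreover have "(\<lambda>N. rqpoch q (int N + 0) * rqpoch q (int N + int k)) \<longlonglongrightarrow> ?i * ?i"
    by (intro tendsto_mult rqpoch_tendsto q)
  ultimately have "infsum (\<lambda>m. ?g m * ?i) UNIV = ?i * ?i"
    using LIMSEQ_unique by auto
  then have "infsum ?g UNIV = ?i"
    using qpoch_inf_nonzero q by (simp add: infsum_cmult_left')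
  then show ?thesis using sg has_sum_infsum by fastforce
qed

text \<open>With j = m + r one has j^2 + s j = (r^2 + s r) + m (m + 2r + s); the terms j < r vanish.
  The free weight \<open>u\<close> serves the finite and the infinite form alike.\<close>

lemma Bailey_reindex_nat:
  fixes u :: "int \<Rightarrow> complex"
  assumes "((\<lambda>m. q ^ (m * (m + (2 * r + s))) * u (int (m + r)) * rqpoch q (int m) * rqpoch q (int (m + (2 * r + s))))
     has_sum S) UNIV"
  shows "((\<lambda>j. q ^ (j ^ 2 + s * j) * u (int j) * rqpoch q (int j - int r) * rqpoch q (int j + int r + int s))
     has_sum q ^ (r ^ 2 + s * r) * S) UNIV"
proof -
  let ?f = "\<lambda>j. q ^ (j ^ 2 + s * j) * u (int j) * rqpoch q (int j - int r) * rqpoch q (int j + int r + int s)"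
  have pow: "q ^ ((m + r) ^ 2 + s * (m + r)) = q ^ (r ^ 2 + s * r) * q ^ (m * (m + (2 * r + s)))" for m
    unfolding power_add[symmetric]
    by (rule arg_cong[where f = "\<lambda>e. q ^ e"]) (simp add: algebra_simps power2_eq_square)
  have idx: "int (m + r) - int r = int m" "int (m + r) + int r + int s = int (m + (2 * r + s))" for m
    by simp_all
  have "((?f \<circ> (\<lambda>m. m + r)) has_sum q ^ (r ^ 2 + s * r) * S) UNIV"
    using has_sum_cmult_right[OF assms, of "q ^ (r ^ 2 + s * r)"]
    unfolding o_def pow idx by (simp only: mult.assoc)
  then have "(?f has_sum q ^ (r ^ 2 + s * r) * S) (range (\<lambda>m. m + r))"
    by (subst has_sum_reindex) auto
  also have "?this \<longleftrightarrow> (?f has_sum q ^ (r ^ 2 + s * r) * S) UNIV"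
  proof (rule has_sum_cong_neutral)
    fix j assume "j \<in> UNIV - range (\<lambda>m. m + r)"
    then have "j < r" by (metis DiffE le_add_diff_inverse2 not_le rangeI)
    then show "?f j = 0" by (simp add: rqpoch_def)
  qed auto
  finally show ?thesis .
qed

text \<open>The map r to -r - s exchanges the two reciprocal factors and fixes r^2 + s r. Since s is
  at most 1, it sends every negative r to a nonnegative one.\<close>

lemma Bailey_reindex:
  fixes u :: "int \<Rightarrow> complex" and r :: int and s :: nat
  assumes "s \<le> 1"
    and "\<And>r::nat. ((\<lambda>m. q ^ (m * (m + (2 * r + s))) * u (int (m + r)) * rqpoch q (int m) * rqpoch q (int (m + (2 * r + s))))
     has_sum S r) UNIV"
    and "\<And>r::nat. T (int r) = S r" "\<And>r. T (- r - int s) = T r"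
  shows "((\<lambda>j. q ^ (j ^ 2 + s * j) * u (int j) * rqpoch q (int j - r) * rqpoch q (int j + r + int s))
     has_sum q powi (r ^ 2 + int s * r) * T r) UNIV"
proof -
  have main: "((\<lambda>j. q ^ (j ^ 2 + s * j) * u (int j) * rqpoch q (int j - int r) * rqpoch q (int j + int r + int s))
     has_sum q powi ((int r) ^ 2 + int s * int r) * T (int r)) UNIV" for r
    using Bailey_reindex_nat[OF assms(2), of r] assms(3)[of r]
    by (simp add: power_int_def nat_add_distrib nat_mult_distrib nat_power_eq)
  consider (pos) k where "r = int k" | (neg) k where "r = - int k - int s"
  proof (cases "r \<ge> 0")
    case True
    then show ?thesis using pos[of "nat r"] by simp
  next
    case False
    then show ?thesis using neg[of "nat (- r - int s)"] assms(1) by simp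
  qed
  then show ?thesis
  proof cases
    case pos
    then show ?thesis using main by simp
  next
    case neg
    have "r ^ 2 + int s * r = (int k) ^ 2 + int s * int k"
      unfolding neg by (simp add: power2_eq_square algebra_simps)
    moreover have "T r = T (int k)" unfolding neg by (rule assms(4))
    moreover have "int j - r = int j + int k + int s" "int j + r + int s = int j - int k" for j
      by (simp_all add: neg)
    ultimately show ?thesis using main[of k] by (simp only: mult_ac)
  qed
qed

text \<open>The kernel 1/((q;q)_{n-r} (q;q)_{n+r+s}) reproduces itself up to q^(r^2 + s r), which is
  what permits a second application.\<close>

lemma Bailey_lemma_finite:
  assumes "s \<le> 1"
  shows "((\<lambda>j. q ^ (j ^ 2 + s * j) * rqpoch q (int n - int j) * rqpoch q (int j - r) * rqpoch q (int j + r + int s))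
     has_sum q powi (r ^ 2 + int s * r) * (rqpoch q (int n - r) * rqpoch q (int n + r + int s))) UNIV"
proof (rule Bailey_reindex[OF assms, where u = "\<lambda>j. rqpoch q (int n - j)"])
  show "((\<lambda>m. q ^ (m * (m + (2 * r + s))) * rqpoch q (int n - int (m + r)) * rqpoch q (int m) * rqpoch q (int (m + (2 * r + s))))
     has_sum rqpoch q (int n - int r) * rqpoch q (int n + int r + int s)) UNIV" for r
    using q_Vandermonde[of "2 * r + s" "int n - int r"] by (simp add: algebra_simps)
qed (simp_all add: mult.commute algebra_simps)

lemma Bailey_lemma_infinite:
  assumes "s \<le> 1"
  shows "((\<lambda>j. q ^ (j ^ 2 + s * j) * rqpoch q (int j - r) * rqpoch q (int j + r + int s))
     has_sum q powi (r ^ 2 + int s * r) * inverse (qpoch_inf q q)) UNIV"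
  using Bailey_reindex[OF assms, where u = "\<lambda>j. 1" and T = "\<lambda>r. inverse (qpoch_inf q q)" and r = r, OF _ refl refl]
    Durfee[of "2 * _ + s"] by (simp only: mult_1_right)

end

section \<open>Summing a Bailey pair against a double weight\<close>

text \<open>The coefficient is 24 = 6 + 2 * 9: the quadratic part of \<open>tsum\<close> plus two
  factors q^(r^2) with r = 3t + d.\<close>

definition theta24 :: "complex \<Rightarrow> int \<Rightarrow> complex" where
  "theta24 q b = (\<Sum>\<^sub>\<infinity>t. q powi (24 * t\<^sup>2 + b * t))"

lemma theta24_uminus: "theta24 q (- b) = theta24 q b"
  unfolding theta24_def using infsum_reflect_int[of "\<lambda>t. q powi (24 * t\<^sup>2 + b * t)" 0] by simp

context
  fixes q :: complex
  assumes q: "norm q < 1" "q \<noteq> 0"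
begin

lemma theta24_shift: "theta24 q b = q powi (24 - b) * theta24 q (b - 48)"
proof -
  have "q powi (24 * (t + -1)\<^sup>2 + b * (t + -1)) = q powi (24 - b) * q powi (24 * t\<^sup>2 + (b - 48) * t)" for t
    using q by (simp add: algebra_simps power2_eq_square flip: power_int_add)
  then show ?thesis
    unfolding theta24_def using infsum_shift_int[of "\<lambda>t. q powi (24 * t\<^sup>2 + b * t)" "-1"]
    by (simp add: infsum_cmult_right')
qed

lemma norm_double_weight:
  "norm (q ^ ((i + j) ^ 2 + s * (i + j) + (j ^ 2 + s * j))) \<le> norm q ^ i * norm q ^ j"
proof -
  have "i + j \<le> (i + j) ^ 2" by (simp add: power2_eq_square)
  then have "norm q ^ ((i + j) ^ 2 + s * (i + j) + (j ^ 2 + s * j)) \<le> norm q ^ (i + j)"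
    using q by (intro power_decreasing) auto
  then show ?thesis unfolding norm_power by (simp only: power_add[of "norm q" i j])
qed

lemma summable_on_norm_q_prod: "(\<lambda>(i, j). norm q ^ i * norm q ^ j) summable_on UNIV"
  using summable_on_product_nonneg[OF summable_on_norm_power[OF q] summable_on_norm_power[OF q]] by simp

text \<open>In the variables n = i + j and j, the inner sum over j is the finite lemma and the outer
  sum over n the infinite one.\<close>

lemma Bailey_lemma_double:
  assumes "s \<le> 1"
  shows "((\<lambda>(i, j). q ^ ((i + j) ^ 2 + s * (i + j) + (j ^ 2 + s * j)) * rqpoch q (int i)
            * rqpoch q (int j - r) * rqpoch q (int j + r + int s))
     has_sum (q powi (r ^ 2 + int s * r)) ^ 2 * inverse (qpoch_inf q q)) UNIV"
proof -
  let ?G = "\<lambda>(i, j). q ^ ((i + j) ^ 2 + s * (i + j) + (j ^ 2 + s * j)) * rqpoch q (int i)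
            * rqpoch q (int j - r) * rqpoch q (int j + r + int s)"
  let ?H = "\<lambda>(n, j). q ^ (n ^ 2 + s * n) * (q ^ (j ^ 2 + s * j) * rqpoch q (int n - int j)
            * rqpoch q (int j - r) * rqpoch q (int j + r + int s))"
  let ?Q = "q powi (r ^ 2 + int s * r)"
  let ?S = "?Q ^ 2 * inverse (qpoch_inf q q)"
  obtain C where C: "C > 0" "\<And>k. norm (rqpoch q k) \<le> C" using rqpoch_bounded q by blast
  have G: "?G summable_on UNIV"
  proof (rule summable_on_norm_bound)
    show "(\<lambda>x. (case x of (i, j) \<Rightarrow> norm q ^ i * norm q ^ j) * (C * C * C)) summable_on UNIV"
      by (rule summable_on_cmult_left[OF summable_on_norm_q_prod])
    show "norm (?G x) \<le> (case x of (i, j) \<Rightarrow> norm q ^ i * norm q ^ j) * (C * C * C)" for x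
      unfolding case_prod_unfold norm_mult mult.assoc
      using C norm_double_weight[of "fst x" "snd x" s] less_imp_le[OF C(1)]
      by (simp only: mult.assoc[symmetric]) (intro mult_mono mult_nonneg_nonneg norm_ge_zero zero_le_power; simp)
  qed
  \<comment> \<open>The image of \<open>h\<close> is the region j <= n; outside it the factor
    \<open>rqpoch q (int n - int j)\<close> is zero, so the sum extends to all pairs.\<close>
  define h :: "nat \<times> nat \<Rightarrow> nat \<times> nat" where "h = (\<lambda>(i, j). (i + j, j))"
  have inj: "inj h" by (auto simp: h_def inj_def)
  have GH: "?G = ?H \<circ> h" by (auto simp: h_def fun_eq_iff power_add)
  have eq: "(?G has_sum S) UNIV \<longleftrightarrow> (?H has_sum S) UNIV" for S
  proof -
    have "(?G has_sum S) UNIV \<longleftrightarrow> (?H has_sum S) (range h)"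
      unfolding GH by (rule has_sum_reindex[OF inj, symmetric])
    also have "\<dots> \<longleftrightarrow> (?H has_sum S) UNIV"
    proof (rule has_sum_cong_neutral)
      fix x assume x: "x \<in> UNIV - range h"
      obtain n j where nj: "x = (n, j)" by (cases x)
      have "x = h (n - j, j)" if "j \<le> n" using that by (simp add: nj h_def)
      with x have "n < j" by (metis DiffD2 not_le rangeI)
      then show "?H x = 0" by (simp add: nj rqpoch_def)
    qed auto
    finally show ?thesis .
  qed
  have H: "?H summable_on UNIV \<times> UNIV"
    using G eq unfolding summable_on_def by auto
  have "(?H has_sum ?S) (UNIV \<times> UNIV)"
  proof (rule has_sum_SigmaI[OF _ _ H])
    show "((\<lambda>j. ?H (n, j)) has_sum q ^ (n ^ 2 + s * n) * (?Q * (rqpoch q (int n - r) * rqpoch q (int n + r + int s)))) UNIV" for n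
      using has_sum_cmult_right[OF Bailey_lemma_finite[OF q assms, of n r], of "q ^ (n ^ 2 + s * n)"] by simp
    show "((\<lambda>n. q ^ (n ^ 2 + s * n) * (?Q * (rqpoch q (int n - r) * rqpoch q (int n + r + int s)))) has_sum ?S) UNIV"
      using has_sum_cmult_right[OF Bailey_lemma_infinite[OF q assms, of r], of ?Q]
      by (simp add: power2_eq_square mult_ac)
  qed
  then show ?thesis unfolding eq by simp
qed

text \<open>Interchange the sum over t with the double sum and apply
  \<open>Bailey_lemma_double\<close> at r = 3t + d; the exponent of q becomes 24 t^2 + (b + 12d +
  6s) t + 2d^2 + 2sd.\<close>

lemma Bailey_tsum:
  assumes "s \<le> 1"
  shows "((\<lambda>(i, j). q ^ ((i + j) ^ 2 + s * (i + j) + (j ^ 2 + s * j)) * rqpoch q (int i)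
            * rqpoch q (int (2 * j + s)) * tsum q (2 * j + s) (int j - d) b)
     has_sum q powi (2 * d\<^sup>2 + 2 * int s * d) * theta24 q (b + 12 * d + 6 * int s) / qpoch_inf q q) UNIV"
proof -
  define W where "W = (\<lambda>(i, j). q ^ ((i + j) ^ 2 + s * (i + j) + (j ^ 2 + s * j)) * rqpoch q (int i))"
  define Z where "Z = (\<lambda>t::int. q powi (6 * t\<^sup>2 + b * t))"
  define R where "R = (\<lambda>j t. rqpoch q (int j - (3 * t + d)) * rqpoch q (int j + (3 * t + d) + int s))"
  define F where "F = (\<lambda>(x, t). W x * Z t * R (snd x) t)"
  obtain C where C: "C > 0" "\<And>k. norm (rqpoch q k) \<le> C" using rqpoch_bounded q by blast
  have W: "norm (W x) \<le> (case x of (i, j) \<Rightarrow> norm q ^ i * norm q ^ j) * C" for x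
    unfolding W_def case_prod_unfold norm_mult
    using C norm_double_weight[of "fst x" "snd x" s] by (intro mult_mono) auto
  have "norm (R j t) \<le> C * C" for j t
    unfolding R_def norm_mult using C by (intro mult_mono) (auto intro: less_imp_le)
  then have F_le: "norm (F (x, t)) \<le> (case x of (i, j) \<Rightarrow> norm q ^ i * norm q ^ j) * C * norm (Z t) * (C * C)" for x t
    unfolding F_def using W[of x] C by (auto simp: norm_mult intro!: mult_mono mult_nonneg_nonneg split: prod.splits)
  have F: "F summable_on UNIV \<times> UNIV"
  proof (rule summable_on_norm_bound)
    have "(\<lambda>(x, t). (case x of (i, j) \<Rightarrow> norm q ^ i * norm q ^ j) * norm (Z t)) summable_on UNIV \<times> UNIV"
      using summable_on_product_nonneg[OF summable_on_norm_q_prod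
          summable_on_quadratic_power_int[OF q(2,1), of 6 b]] by (auto simp: Z_def)
    then show "(\<lambda>(x, t). (case x of (i, j) \<Rightarrow> norm q ^ i * norm q ^ j) * norm (Z t) * (C * C * C)) summable_on UNIV \<times> UNIV"
      unfolding case_prod_unfold by (rule summable_on_cmult_left)
  qed (use F_le in \<open>auto simp: mult_ac\<close>)
  obtain X where X: "(F has_sum X) (UNIV \<times> UNIV)" using F unfolding summable_on_def by blast
  have "((\<lambda>(t, x). F (x, t)) has_sum X) (UNIV \<times> UNIV)"
    using X has_sum_swap[where f = F and A = UNIV and B = UNIV] by simp
  then have "((\<lambda>t. Z t * ((q powi ((3 * t + d) ^ 2 + int s * (3 * t + d))) ^ 2 * inverse (qpoch_inf q q))) has_sum X) UNIV"
  proof (rule has_sum_SigmaD)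
    show "((\<lambda>x. case (t, x) of (t, x) \<Rightarrow> F (x, t)) has_sum
        Z t * ((q powi ((3 * t + d) ^ 2 + int s * (3 * t + d))) ^ 2 * inverse (qpoch_inf q q))) UNIV" for t
      using has_sum_cmult_right[OF Bailey_lemma_double[OF assms, of "3 * t + d"], of "Z t"]
      by (simp add: F_def W_def R_def case_prod_unfold mult_ac)
  qed
  then have "X = (\<Sum>\<^sub>\<infinity>t. Z t * ((q powi ((3 * t + d) ^ 2 + int s * (3 * t + d))) ^ 2 * inverse (qpoch_inf q q)))"
    using infsumI by blast
  also have "\<dots> = (\<Sum>\<^sub>\<infinity>t. (q powi (2 * d\<^sup>2 + 2 * int s * d) * inverse (qpoch_inf q q))
       * q powi (24 * t\<^sup>2 + (b + 12 * d + 6 * int s) * t))"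
  proof (rule infsum_cong)
    fix t :: int
    have "Z t * (q powi ((3 * t + d) ^ 2 + int s * (3 * t + d))) ^ 2
       = q powi (2 * d\<^sup>2 + 2 * int s * d) * q powi (24 * t\<^sup>2 + (b + 12 * d + 6 * int s) * t)"
      using q unfolding Z_def power2_eq_square[of "q powi _"]
      by (simp add: algebra_simps power2_eq_square flip: power_int_add)
    then show "Z t * ((q powi ((3 * t + d) ^ 2 + int s * (3 * t + d))) ^ 2 * inverse (qpoch_inf q q))
      = (q powi (2 * d\<^sup>2 + 2 * int s * d) * inverse (qpoch_inf q q))
       * q powi (24 * t\<^sup>2 + (b + 12 * d + 6 * int s) * t)" by (simp add: mult_ac)
  qed
  also have "\<dots> = q powi (2 * d\<^sup>2 + 2 * int s * d) * theta24 q (b + 12 * d + 6 * int s) / qpoch_inf q q"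
    unfolding theta24_def infsum_cmult_right' by (simp add: divide_inverse mult_ac)
  finally have X_eq: "X = q powi (2 * d\<^sup>2 + 2 * int s * d) * theta24 q (b + 12 * d + 6 * int s) / qpoch_inf q q" .
  have "((\<lambda>x. W x * rqpoch q (int (2 * snd x + s)) * tsum q (2 * snd x + s) (int (snd x) - d) b) has_sum X) UNIV"
  proof (rule has_sum_SigmaD[OF X])
    fix x :: "nat \<times> nat"
    let ?n = "2 * snd x + s"
    have "qpoch q q ?n \<noteq> 0" using qpoch_nonzero q by blast
    then have n: "rqpoch q (int ?n) * qpoch q q ?n = 1" by (simp add: rqpoch_def del: of_nat_add)
    \<comment> \<open>Dividing the binomial of row 2j + s by (q;q)_{2j+s} leaves exactly the Bailey
      kernel at r = 3t + d.\<close>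
    have "rqpoch q (int ?n) * qbinom q ?n (int (snd x) - d - 3 * t) = R (snd x) t" for t
    proof -
      have "rqpoch q (int ?n) * qbinom q ?n (int (snd x) - d - 3 * t)
         = (rqpoch q (int ?n) * qpoch q q ?n) * (rqpoch q (int (snd x) - d - 3 * t)
           * rqpoch q (int ?n - (int (snd x) - d - 3 * t)))"
        by (simp add: qbinom_def)
      also have "\<dots> = R (snd x) t" unfolding n R_def by (simp add: algebra_simps)
      finally show ?thesis .
    qed
    then have "F (x, t) = W x * rqpoch q (int ?n) * (Z t * qbinom q ?n (int (snd x) - d - 3 * t))" for t
      unfolding F_def by (simp add: mult_ac)
    then show "((\<lambda>t. F (x, t)) has_sum W x * rqpoch q (int ?n) * tsum q ?n (int (snd x) - d) b) UNIV"
      unfolding tsum_def Z_def by (simp add: has_sum_cmult_right[OF has_sum_infsum[OF tsum_summable]])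
  qed
  then show ?thesis unfolding X_eq W_def by (simp add: case_prod_unfold)
qed

end

section \<open>Jacobi's triple product\<close>

definition tri :: "int \<Rightarrow> int" where
  "tri r = r * (r - 1) div 2"

lemma two_tri: "2 * tri r = r * (r - 1)"
  by (simp add: tri_def)

lemma tri_Suc: "tri (r + 1) = tri r + r"
  using two_tri[of r] two_tri[of "r + 1"] by (simp add: algebra_simps)

lemma has_sum_shift_int:
  "((\<lambda>r::int. f (r + c)) has_sum S) UNIV \<longleftrightarrow> (f has_sum S) UNIV"
  by (rule has_sum_reindex_bij_witness[of _ "\<lambda>r. r - c" "\<lambda>r. r + c"]) auto

context
  fixes q :: complex
  assumes q: "norm q < 1" "q \<noteq> 0"
begin

text \<open>Two Pascal steps lead from row 2n to row 2n + 2. Each adds a copy of the series shifted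
  by one in r, which multiplies the sum by one linear factor.\<close>

lemma Jacobi_triple_finite:
  assumes "w \<noteq> 0"
  shows "((\<lambda>r. w powi r * q powi (tri r) * qbinom q (2 * n) (int n - r))
      has_sum (\<Prod>k<n. (1 + w * q ^ k) * (1 + q ^ (k + 1) / w))) UNIV"
proof (induction n)
  case 0
  show ?case
    by (intro has_sum_finite_neutralI[of "{0}"]) (auto simp: qbinom_0 tri_def)
next
  case (Suc n)
  let ?P = "\<Prod>k<n. (1 + w * q ^ k) * (1 + q ^ (k + 1) / w)"
  define A where "A = (\<lambda>r. w powi r * q powi (tri r) * qbinom q (2 * n) (int n - r))"
  \<comment> \<open>The intermediate odd row, whose sum already has the factor 1 + w q^n but not yet
    1 + q^(n+1)/w.\<close>
  define B where "B = (\<lambda>r. w powi r * q powi (tri r) * qbinom q (2 * n + 1) (int n + 1 - r))"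
  have A: "(A has_sum ?P) UNIV" using Suc by (simp add: A_def)
  have "B r = A r + w * q ^ n * A (r - 1)" for r
  proof -
    have qb: "qbinom q (2 * n + 1) (int n + 1 - r)
       = qbinom q (2 * n) (int n - r) + q powi (int n - (r - 1)) * qbinom q (2 * n) (int n - (r - 1))"
      using qbinom_Suc[OF q, of "2 * n" "int n + 1 - r"] by (simp add: algebra_simps)
    have w: "w powi r = w * w powi (r - 1)"
      using assms by (simp add: power_int_diff)
    have "q powi (tri r) * q powi (int n - (r - 1)) = q powi (tri (r - 1) + int n)"
      using tri_Suc[of "r - 1"] q by (simp flip: power_int_add)
    also have "\<dots> = q ^ n * q powi (tri (r - 1))"
      using q by (simp add: power_int_add)
    finally have "w powi r * q powi (tri r) * (q powi (int n - (r - 1)) * qbinom q (2 * n) (int n - (r - 1)))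
       = w * q ^ n * A (r - 1)"
      unfolding A_def w by (simp add: mult_ac)
    then show ?thesis unfolding B_def qb distrib_left by (simp add: A_def)
  qed
  then have B_eq: "B = (\<lambda>r. A r + w * q ^ n * A (r - 1))" by blast
  have "(B has_sum ?P + w * q ^ n * ?P) UNIV"
    unfolding B_eq
    using has_sum_shift_int[of A "-1" ?P] A
    by (intro has_sum_add has_sum_cmult_right) auto
  then have B: "(B has_sum ?P * (1 + w * q ^ n)) UNIV"
    by (simp add: algebra_simps)
  have "w powi r * q powi (tri r) * qbinom q (2 * Suc n) (int (Suc n) - r) = B r + q ^ (n + 1) / w * B (r + 1)" for r
  proof -
    have qb: "qbinom q (2 * Suc n) (int (Suc n) - r)
       = qbinom q (2 * n + 1) (int n + 1 - r) + q powi (int (n + 1) + r) * qbinom q (2 * n + 1) (int n + 1 - (r + 1))"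
      using qbinom_Suc'[OF q, of "2 * n + 1" "int n + 1 - r"] by (simp add: algebra_simps)
    have w: "w powi r = w powi (r + 1) / w"
      using assms by (simp add: power_int_add)
    have "q powi (tri r) * q powi (int (n + 1) + r) = q powi (tri (r + 1) + int (n + 1))"
      using tri_Suc[of r] q by (simp flip: power_int_add add: algebra_simps)
    also have "\<dots> = q ^ (n + 1) * q powi (tri (r + 1))"
      using q by (simp add: power_int_add)
    finally have "w powi r * q powi (tri r) * (q powi (int (n + 1) + r) * qbinom q (2 * n + 1) (int n + 1 - (r + 1)))
       = q ^ (n + 1) / w * B (r + 1)"
      unfolding B_def w by (simp add: mult_ac)
    then show ?thesis unfolding qb distrib_left by (simp add: B_def)
  qed
  then have eq: "(\<lambda>r. w powi r * q powi (tri r) * qbinom q (2 * Suc n) (int (Suc n) - r))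
      = (\<lambda>r. B r + q ^ (n + 1) / w * B (r + 1))" by blast
  have alg: "p * a + b * (p * a) = p * (a * (1 + b))" for p a b :: complex
    by (simp add: algebra_simps)
  have "((\<lambda>r. B r + q ^ (n + 1) / w * B (r + 1)) has_sum
      ?P * (1 + w * q ^ n) + q ^ (n + 1) / w * (?P * (1 + w * q ^ n))) UNIV"
    using has_sum_shift_int[of B 1] B by (intro has_sum_add has_sum_cmult_right) auto
  then show ?case unfolding eq alg prod.lessThan_Suc .
qed

lemma summable_on_Jacobi_triple:
  assumes "w \<noteq> 0"
  shows "(\<lambda>r. norm (w powi r * q powi (tri r))) summable_on UNIV"
proof -
  \<comment> \<open>Writing |w| = |q|^y turns the terms into powers of |q| with a quadratic
    exponent.\<close>
  define y where "y = log (norm q) (norm w)"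
  have w: "norm w = norm q powr y"
    using q assms by (simp add: y_def)
  have "norm (w powi r * q powi (tri r)) = norm q powr (1/2 * of_int r ^ 2 + (y - 1/2) * of_int r)" for r
  proof -
    have "real_of_int (tri r) = of_int (r * (r - 1)) / 2"
      using two_tri[of r, symmetric] by simp
    then have e: "y * of_int r + of_int (tri r) = 1/2 * of_int r ^ 2 + (y - 1/2) * of_int r"
      by (simp add: power2_eq_square field_simps)
    have "norm (w powi r * q powi (tri r)) = norm w powr of_int r * norm q powr of_int (tri r)"
      using q assms by (simp add: norm_mult norm_power_int powr_real_of_int')
    also have "\<dots> = norm q powr (y * of_int r + of_int (tri r))"
      by (simp add: w powr_powr powr_add)
    finally show ?thesis unfolding e .
  qed
  then show ?thesis
    using summable_on_quadratic_powr[of "norm q" "1/2" "y - 1/2"] q by simp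
qed

theorem Jacobi_triple_product:
  assumes "z \<noteq> 0"
  shows "(\<Sum>\<^sub>\<infinity>r. (- z) powi r * q powi (tri r)) = qpochs_inf [z, q / z, q] q"
proof -
  let ?f = "\<lambda>r. (- z) powi r * q powi (tri r)"
  let ?i = "inverse (qpoch_inf q q)"
  obtain C where C: "C > 0" "\<And>n k. norm (qbinom q n k) \<le> C" using qbinom_bounded q by blast
  have "(\<lambda>n. \<Sum>\<^sub>\<infinity>r. ?f r * qbinom q (2 * n) (int n - r)) \<longlonglongrightarrow> (\<Sum>\<^sub>\<infinity>r. ?f r * ?i)"
  proof (rule infsum_dominated_convergence)
    show "(\<lambda>n. ?f r * qbinom q (2 * n) (int n - r)) \<longlonglongrightarrow> ?f r * ?i" for r
      by (intro tendsto_mult tendsto_const qbinom_tendsto q)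
    show "norm (?f r * qbinom q (2 * n) (int n - r)) \<le> norm (?f r) * C" for n r
      unfolding norm_mult[of "?f r"] using C by (intro mult_left_mono) auto
    show "(\<lambda>r. norm (?f r) * C) summable_on UNIV"
      using assms by (intro summable_on_cmult_left summable_on_Jacobi_triple) auto
  qed
  moreover have "(\<Sum>\<^sub>\<infinity>r. ?f r * qbinom q (2 * n) (int n - r)) = qpoch z q n * qpoch (q / z) q n" for n
    using infsumI[OF Jacobi_triple_finite[of "- z" n]] assms
    by (simp add: qpoch_def prod.distrib)
  moreover have "(\<lambda>n. qpoch z q n * qpoch (q / z) q n) \<longlonglongrightarrow> qpoch_inf z q * qpoch_inf (q / z) q"
    by (intro tendsto_mult qpoch_tendsto q)
  ultimately have "(\<Sum>\<^sub>\<infinity>r. ?f r) * ?i = qpoch_inf z q * qpoch_inf (q / z) q"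
    using LIMSEQ_unique unfolding infsum_cmult_left' by auto
  then show ?thesis
    using qpoch_inf_nonzero[OF q(1)] by (simp add: qpochs_inf_def field_simps)
qed

end

lemma qpochs_inf_trisect:
  assumes "norm q < 1"
  shows "qpochs_inf [q, q ^ 2, q ^ 3] (q ^ 3) = qpoch_inf q q"
proof -
  have q3: "norm (q ^ 3) < 1" using assms by (simp add: norm_power power_less_one_iff)
  have "qpoch q q (3 * n) = qpoch q (q ^ 3) n * qpoch (q ^ 2) (q ^ 3) n * qpoch (q ^ 3) (q ^ 3) n" for n
  proof (induction n)
    case (Suc n)
    have step: "qpoch q q (3 * Suc n) = qpoch q q (3 * n) * (1 - q * q ^ (3 * n)) * (1 - q ^ 2 * q ^ (3 * n)) * (1 - q ^ 3 * q ^ (3 * n))"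
    proof -
      have "3 * Suc n = Suc (Suc (Suc (3 * n)))" by simp
      then show ?thesis by (simp only: qpoch_Suc power_Suc power2_eq_square power3_eq_cube mult.assoc)
    qed
    show ?case unfolding step Suc.IH qpoch_Suc power_mult by (simp only: mult_ac)
  qed (simp add: qpoch_def)
  moreover have "(\<lambda>n. qpoch q (q ^ 3) n * qpoch (q ^ 2) (q ^ 3) n * qpoch (q ^ 3) (q ^ 3) n)
      \<longlonglongrightarrow> qpoch_inf q (q ^ 3) * qpoch_inf (q ^ 2) (q ^ 3) * qpoch_inf (q ^ 3) (q ^ 3)"
    by (intro tendsto_mult qpoch_tendsto q3)
  moreover have "(\<lambda>n. qpoch q q (3 * n)) \<longlonglongrightarrow> qpoch_inf q q"
    by (rule filterlim_compose[OF qpoch_tendsto[OF assms]]) (simp add: mult_nat_left_at_top)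
  ultimately have "qpoch_inf q (q ^ 3) * qpoch_inf (q ^ 2) (q ^ 3) * qpoch_inf (q ^ 3) (q ^ 3) = qpoch_inf q q"
    using LIMSEQ_unique by auto
  then show ?thesis by (simp add: qpochs_inf_def mult.assoc)
qed

section \<open>The quintuple product\<close>

lemma power_powi: "(x ^ n) powi t = x powi (int n * t)" for x :: "'a::field"
  by (simp add: power_int_mult)

lemma minus_one_powi_even: "(- 1 :: complex) powi (2 * t) = 1"
  by (simp add: power_int_mult)

text \<open>Euler's pentagonal number theorem in base p^4: the triple product with base p^12 and z =
  p^8, whose three factors run through the residues modulo 3.\<close>

lemma pentagonal:
  fixes p :: complex
  assumes p: "norm p < 1" "p \<noteq> 0"
  shows "(\<Sum>\<^sub>\<infinity>n. (- 1) powi n * p powi (6 * n\<^sup>2 + 2 * n)) = qpoch_inf (p ^ 4) (p ^ 4)"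
proof -
  have n12: "norm (p ^ 12) < 1" "p ^ 12 \<noteq> 0" and n4: "norm (p ^ 4) < 1"
    using p by (simp_all add: norm_power power_less_one_iff)
  have "(- (p ^ 8)) powi n * (p ^ 12) powi (tri n) = (- 1) powi n * p powi (6 * n\<^sup>2 + 2 * n)" for n
  proof -
    have "(- (p ^ 8)) powi n = (- 1) powi n * p powi (8 * n)"
      using power_int_mult_distrib[of "- 1" "p ^ 8" n] by (simp add: power_powi)
    moreover have "(p ^ 12) powi (tri n) = p powi (6 * (2 * tri n))"
      by (simp add: power_powi)
    moreover have "p powi (8 * n) * p powi (6 * (2 * tri n)) = p powi (6 * n\<^sup>2 + 2 * n)"
      unfolding two_tri using p by (simp add: power2_eq_square algebra_simps flip: power_int_add)
    ultimately show ?thesis by (simp add: mult.assoc)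
  qed
  then have "(\<Sum>\<^sub>\<infinity>n. (- 1) powi n * p powi (6 * n\<^sup>2 + 2 * n)) = qpochs_inf [p ^ 8, p ^ 12 / p ^ 8, p ^ 12] (p ^ 12)"
    using Jacobi_triple_product[OF n12, of "p ^ 8"] p by simp
  also have "p ^ 12 / p ^ 8 = p ^ 4"
    using p by (simp add: field_simps flip: power_add)
  also have "qpochs_inf [p ^ 8, p ^ 4, p ^ 12] (p ^ 12) = qpochs_inf [p ^ 4, (p ^ 4)\<^sup>2, (p ^ 4) ^ 3] ((p ^ 4) ^ 3)"
    by (simp add: qpochs_inf_def mult_ac flip: power_mult)
  also have "\<dots> = qpoch_inf (p ^ 4) (p ^ 4)"
    by (rule qpochs_inf_trisect[OF n4])
  finally show ?thesis .
qed

text \<open>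
  Multiply the triple product series for \<open>z\<close> and \<open>p\<^sup>2 z\<^sup>2\<close>, indexed by \<open>m\<close> and \<open>n\<close>, and group the
  terms by \<open>m + 2 n = 3 t + e\<close>, writing \<open>n = k + t\<close>. The sum over \<open>k\<close> is the pentagonal series for
  \<open>e = 0\<close> and \<open>e = 1\<close>, and it vanishes for \<open>e = 2\<close>.
\<close>

theorem quintuple_product:
  fixes p z :: complex
  assumes p: "norm p < 1" "p \<noteq> 0" and z: "z \<noteq> 0"
  shows "qpochs_inf [z, p\<^sup>2 / z, p\<^sup>2] (p\<^sup>2) * qpochs_inf [p\<^sup>2 * z\<^sup>2, p\<^sup>2 / z\<^sup>2] (p ^ 4)
    = (\<Sum>\<^sub>\<infinity>t. z powi (3 * t) * p powi (3 * t\<^sup>2 - t)) - (\<Sum>\<^sub>\<infinity>t. z powi (3 * t + 1) * p powi (3 * t\<^sup>2 + t))"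
proof -
  have n2: "norm (p\<^sup>2) < 1" "p\<^sup>2 \<noteq> 0" and n4: "norm (p ^ 4) < 1" "p ^ 4 \<noteq> 0"
    using p by (simp_all add: norm_power power_less_one_iff)
  define a where "a = (\<lambda>m. (- z) powi m * (p\<^sup>2) powi (tri m))"
  define b where "b = (\<lambda>n. (- (p\<^sup>2 * z\<^sup>2)) powi n * (p ^ 4) powi (tri n))"
  define c where "c = (\<lambda>e k :: int. (- 1) powi k * p powi (6 * k\<^sup>2 + 2 * k - 4 * k * e))"
  define d where "d = (\<lambda>e t :: int. (- 1) powi e * z powi (3 * t + e) * p powi (3 * t\<^sup>2 - t + 2 * t * e + e\<^sup>2 - e))"
  let ?E = "qpoch_inf (p ^ 4) (p ^ 4)"
  let ?L = "qpochs_inf [z, p\<^sup>2 / z, p\<^sup>2] (p\<^sup>2) * qpochs_inf [p\<^sup>2 * z\<^sup>2, p\<^sup>2 / z\<^sup>2] (p ^ 4)"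
  have a_sum: "infsum a UNIV = qpochs_inf [z, p\<^sup>2 / z, p\<^sup>2] (p\<^sup>2)"
    unfolding a_def by (rule Jacobi_triple_product[OF n2 z])
  have "infsum b UNIV = qpochs_inf [p\<^sup>2 * z\<^sup>2, p ^ 4 / (p\<^sup>2 * z\<^sup>2), p ^ 4] (p ^ 4)"
    unfolding b_def using p z by (intro Jacobi_triple_product[OF n4]) auto
  also have "p ^ 4 / (p\<^sup>2 * z\<^sup>2) = p\<^sup>2 / z\<^sup>2"
    using p by (simp add: power2_eq_square power4_eq_xxxx)
  finally have b_sum: "infsum b UNIV = qpochs_inf [p\<^sup>2 * z\<^sup>2, p\<^sup>2 / z\<^sup>2] (p ^ 4) * ?E"
    by (simp add: qpochs_inf_def mult_ac)
  have a: "(\<lambda>m. norm (a m)) summable_on UNIV"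
    unfolding a_def using z by (intro summable_on_Jacobi_triple[OF n2]) auto
  have b: "(\<lambda>n. norm (b n)) summable_on UNIV"
    unfolding b_def using p z by (intro summable_on_Jacobi_triple[OF n4]) auto
  have a_eq: "a m = (- 1) powi m * z powi m * p powi (m\<^sup>2 - m)" for m
  proof -
    have "(p\<^sup>2) powi (tri m) = p powi (m\<^sup>2 - m)"
      unfolding power_powi of_nat_numeral two_tri by (simp add: power2_eq_square algebra_simps)
    then show ?thesis using power_int_mult_distrib[of "- 1" z m] by (simp add: a_def)
  qed
  have b_eq: "b n = (- 1) powi n * z powi (2 * n) * p powi (2 * n\<^sup>2)" for n
  proof -
    have "(- (p\<^sup>2 * z\<^sup>2)) powi n = (- 1) powi n * (p powi (2 * n) * z powi (2 * n))"
      using power_int_mult_distrib[of "- 1" "p\<^sup>2 * z\<^sup>2" n] by (simp add: power_int_mult_distrib power_powi)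
    moreover have "(p ^ 4) powi (tri n) = p powi (2 * (2 * tri n))"
      by (simp add: power_powi)
    moreover have "p powi (2 * n) * p powi (2 * (2 * tri n)) = p powi (2 * n\<^sup>2)"
      unfolding two_tri using p by (simp add: power2_eq_square algebra_simps flip: power_int_add)
    ultimately show ?thesis by (simp add: b_def mult_ac)
  qed
  \<comment> \<open>The variables t and k separate because the cross terms in m^2 + 2 n^2, with m =
    t + e - 2k and n = k + t, are -4tk and +4tk.\<close>
  have ab: "a (t + e - 2 * k) * b (k + t) = d e t * c e k" for t e k
  proof -
    have "(- 1 :: complex) powi (t + e - 2 * k) * (- 1) powi (k + t) = (- 1) powi (t + e - 2 * k + (k + t))"
      by (rule power_int_add[symmetric]) simp
    also have "t + e - 2 * k + (k + t) = e + k + 2 * (t - k)" by simp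
    also have "(- 1 :: complex) powi \<dots> = (- 1) powi (e + k) * (- 1) powi (2 * (t - k))"
      by (rule power_int_add) simp
    also have "\<dots> = (- 1) powi e * (- 1) powi k"
      unfolding minus_one_powi_even by (simp add: power_int_add)
    finally have s: "(- 1 :: complex) powi (t + e - 2 * k) * (- 1) powi (k + t) = (- 1) powi e * (- 1) powi k" .
    have zz: "z powi (t + e - 2 * k) * z powi (2 * (k + t)) = z powi (3 * t + e)"
      using z by (simp add: algebra_simps flip: power_int_add)
    have pp: "p powi ((t + e - 2 * k)\<^sup>2 - (t + e - 2 * k)) * p powi (2 * (k + t)\<^sup>2)
        = p powi (3 * t\<^sup>2 - t + 2 * t * e + e\<^sup>2 - e) * p powi (6 * k\<^sup>2 + 2 * k - 4 * k * e)"
      using p by (simp add: power2_eq_square algebra_simps flip: power_int_add)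
    have "a (t + e - 2 * k) * b (k + t) = ((- 1) powi (t + e - 2 * k) * (- 1) powi (k + t))
        * (z powi (t + e - 2 * k) * z powi (2 * (k + t)))
        * (p powi ((t + e - 2 * k)\<^sup>2 - (t + e - 2 * k)) * p powi (2 * (k + t)\<^sup>2))"
      unfolding a_eq b_eq by (simp only: mult_ac)
    also have "\<dots> = d e t * c e k"
      unfolding s zz pp c_def d_def by (simp only: mult_ac)
    finally show ?thesis .
  qed
  have idx: "3 * ((m + 2 * n) div 3) + ((m + 2 * n) mod 3 - 2 * n) = m" for m n :: int
    using mult_div_mod_eq[of 3 "m + 2 * n"] by linarith
  let ?h = "\<lambda>(e, t, k). d e t * c e k"
  have "((\<lambda>(m, n). a m * b n) has_sum ?L * ?E) (UNIV \<times> UNIV)"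
    using has_sum_product[OF a b] unfolding a_sum b_sum by (simp add: mult_ac)
  also have "?this \<longleftrightarrow> (?h has_sum ?L * ?E) ({0..2} \<times> UNIV \<times> UNIV)"
    by (rule has_sum_reindex_bij_witness[of _ "\<lambda>(e, t, k). (t + e - 2 * k, k + t)"
        "\<lambda>(m, n). ((m + 2 * n) mod 3, (m + 2 * n) div 3, n - (m + 2 * n) div 3)"])
       (auto simp: ab[symmetric] idx)
  finally have h: "(?h has_sum ?L * ?E) ({0..2} \<times> UNIV \<times> UNIV)" .
  then have h_summable: "?h summable_on {0..2} \<times> UNIV \<times> UNIV"
    by (rule has_sum_imp_summable)
  have inner: "(\<Sum>\<^sub>\<infinity>y. ?h (e, y)) = infsum (d e) UNIV * infsum (c e) UNIV" if "e \<in> {0..2}" for e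
  proof -
    have "(\<lambda>y. ?h (e, y)) summable_on UNIV \<times> UNIV"
      using summable_on_SigmaD1[of "\<lambda>e y. ?h (e, y)" "{0..2}" "\<lambda>_. UNIV \<times> UNIV" e] h_summable that by simp
    then have "(\<Sum>\<^sub>\<infinity>t. \<Sum>\<^sub>\<infinity>k. ?h (e, t, k)) = (\<Sum>\<^sub>\<infinity>y\<in>UNIV \<times> UNIV. ?h (e, y))"
      by (rule infsum_Sigma_banach)
    then show ?thesis by (simp add: infsum_cmult_left' infsum_cmult_right')
  qed
  have c0: "infsum (c 0) UNIV = ?E"
    unfolding c_def using pentagonal[OF p] by simp
  have "c 1 k = c 0 (0 - k)" for k
    using power_int_mult_distrib[of "- 1 :: complex" "- 1" k] by (simp add: c_def power_int_minus field_simps)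
  then have c1: "infsum (c 1) UNIV = ?E"
    using infsum_reflect_int[of "c 0" 0] c0 by (metis (mono_tags, lifting) infsum_cong)
  \<comment> \<open>For e = 2 the exponent is 6k^2 - 6k, symmetric about k = 1/2, while the sign
    alternates.\<close>
  have c2_reflect: "c 2 (1 - k) = - c 2 k" for k
  proof -
    have "(- 1 :: complex) powi (1 - k) = - ((- 1) powi k)"
      using minus_one_powi_even[of k] by (simp add: power_int_diff mult_2 power_int_add field_simps)
    moreover have "6 * (1 - k)\<^sup>2 + 2 * (1 - k) - 4 * (1 - k) * 2 = 6 * k\<^sup>2 + 2 * k - 4 * k * 2"
      by (simp add: power2_eq_square algebra_simps)
    ultimately show ?thesis unfolding c_def by (simp only: mult_minus_left)
  qed
  have "infsum (c 2) UNIV = - infsum (c 2) UNIV"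
    using infsum_reflect_int[of "c 2" 1] unfolding c2_reflect infsum_uminus by simp
  then have c2: "infsum (c 2) UNIV = 0" by simp
  have "{0..2} = {0, 1, 2 :: int}" by auto
  then have "?L * ?E = (\<Sum>e\<in>{0, 1, 2}. infsum (d e) UNIV * infsum (c e) UNIV)"
    using infsum_Sigma_banach[OF h_summable] infsumI[OF h] inner by simp
  also have "\<dots> = (infsum (d 0) UNIV + infsum (d 1) UNIV) * ?E"
    by (simp add: c0 c1 c2 distrib_right)
  finally have "?L = infsum (d 0) UNIV + infsum (d 1) UNIV"
    using qpoch_inf_nonzero[OF n4(1)] by simp
  then show ?thesis
    unfolding d_def by (simp add: infsum_uminus algebra_simps)
qed

section \<open>The six double sums\<close>

context
  fixes q :: complex
  assumes q: "norm q < 1" "q \<noteq> 0"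
begin

text \<open>The quintuple product at p = q^8, z = q^c; the bound on \<open>c\<close> makes the
  truncated subtractions in the exponents exact.\<close>

lemma quintuple_theta24:
  assumes "c < 8"
  shows "qpochs_inf [q ^ c, q ^ (16 - c), q ^ 16] (q ^ 16) * qpochs_inf [q ^ (16 - 2 * c), q ^ (16 + 2 * c)] (q ^ 32)
    = theta24 q (3 * int c - 8) - q ^ c * theta24 q (3 * int c + 8)"
proof -
  have p: "norm (q ^ 8) < 1" "q ^ 8 \<noteq> 0"
    using q by (simp_all add: norm_power power_less_one_iff)
  have p2: "(q ^ 8)\<^sup>2 = q ^ 16" "(q ^ 8) ^ 4 = q ^ 32" by (simp_all flip: power_mult)
  have e1: "q ^ 16 / q ^ c = q ^ (16 - c)" and e2: "q ^ 16 / (q ^ c)\<^sup>2 = q ^ (16 - 2 * c)"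
    and e3: "q ^ 16 * (q ^ c)\<^sup>2 = q ^ (16 + 2 * c)"
    using q assms by (simp_all add: power_diff power_add mult.commute[of 2 c] power_mult)
  have t1: "(q ^ c) powi (3 * t) * (q ^ 8) powi (3 * t\<^sup>2 - t) = q powi (24 * t\<^sup>2 + (3 * int c - 8) * t)" for t
    using q by (simp add: power_powi algebra_simps flip: power_int_add)
  have t2: "(q ^ c) powi (3 * t + 1) * (q ^ 8) powi (3 * t\<^sup>2 + t) = q ^ c * q powi (24 * t\<^sup>2 + (3 * int c + 8) * t)" for t
  proof -
    have "(q ^ c) powi (3 * t + 1) * (q ^ 8) powi (3 * t\<^sup>2 + t) = q powi (int c + (24 * t\<^sup>2 + (3 * int c + 8) * t))"
      using q by (simp add: power_powi algebra_simps flip: power_int_add)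
    then show ?thesis using q by (simp add: power_int_add)
  qed
  have z: "q ^ c \<noteq> 0" using q by simp
  show ?thesis
    using quintuple_product[OF p z]
    unfolding p2 e1 e2 e3 t1 t2 infsum_cmult_right' theta24_def
    by (simp add: qpochs_inf_def mult_ac)
qed

lemma rqpoch_of_nat: "rqpoch q (int n) = 1 / qpoch q q n"
  by (simp add: rqpoch_def divide_inverse)

text \<open>The two theta series come from the indices r congruent to \<open>d\<close> and to
  \<open>d'\<close> modulo 3.\<close>

lemma Bailey_pair_sum:
  assumes "s \<le> 1"
    and pair: "\<And>j. tsum q (2 * j + s) (int j - d) b - e * tsum q (2 * j + s) (int j - d') b' = \<beta> j"
  shows "((\<lambda>(i, j). q ^ ((i + j) ^ 2 + s * (i + j) + (j ^ 2 + s * j)) / (qpoch q q i * qpoch q q (2 * j + s)) * \<beta> j)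
     has_sum (q powi (2 * d\<^sup>2 + 2 * int s * d) * theta24 q (b + 12 * d + 6 * int s)
        - e * (q powi (2 * d'\<^sup>2 + 2 * int s * d') * theta24 q (b' + 12 * d' + 6 * int s))) / qpoch_inf q q) UNIV"
proof -
  let ?V = "\<lambda>i j. q ^ ((i + j) ^ 2 + s * (i + j) + (j ^ 2 + s * j)) * rqpoch q (int i) * rqpoch q (int (2 * j + s))"
  have "((\<lambda>x. (case x of (i, j) \<Rightarrow> ?V i j * tsum q (2 * j + s) (int j - d) b)
      + - e * (case x of (i, j) \<Rightarrow> ?V i j * tsum q (2 * j + s) (int j - d') b'))
     has_sum q powi (2 * d\<^sup>2 + 2 * int s * d) * theta24 q (b + 12 * d + 6 * int s) / qpoch_inf q q
       + - e * (q powi (2 * d'\<^sup>2 + 2 * int s * d') * theta24 q (b' + 12 * d' + 6 * int s) / qpoch_inf q q)) UNIV"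
    by (intro has_sum_add has_sum_cmult_right Bailey_tsum q assms(1))
  also have "(\<lambda>x. (case x of (i, j) \<Rightarrow> ?V i j * tsum q (2 * j + s) (int j - d) b)
      + - e * (case x of (i, j) \<Rightarrow> ?V i j * tsum q (2 * j + s) (int j - d') b'))
     = (\<lambda>(i, j). q ^ ((i + j) ^ 2 + s * (i + j) + (j ^ 2 + s * j)) / (qpoch q q i * qpoch q q (2 * j + s)) * \<beta> j)"
  proof
    fix x :: "nat \<times> nat"
    obtain i j where x: "x = (i, j)" by (cases x)
    have V: "?V i j = q ^ ((i + j) ^ 2 + s * (i + j) + (j ^ 2 + s * j)) / (qpoch q q i * qpoch q q (2 * j + s))"
      unfolding rqpoch_of_nat by simp
    have "?V i j * tsum q (2 * j + s) (int j - d) b + - e * (?V i j * tsum q (2 * j + s) (int j - d') b')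
      = ?V i j * \<beta> j"
      unfolding pair[symmetric] by (simp add: algebra_simps)
    then show "(case x of (i, j) \<Rightarrow> ?V i j * tsum q (2 * j + s) (int j - d) b)
      + - e * (case x of (i, j) \<Rightarrow> ?V i j * tsum q (2 * j + s) (int j - d') b')
     = (case x of (i, j) \<Rightarrow> q ^ ((i + j) ^ 2 + s * (i + j) + (j ^ 2 + s * j)) / (qpoch q q i * qpoch q q (2 * j + s)) * \<beta> j)"
      unfolding x prod.case V .
  qed
  finally show ?thesis by (simp add: diff_divide_distrib)
qed

lemma double_sum_1:
  "((\<lambda>(i, j). q ^ (i^2 + 2*i*j + 2*j^2) / (qpoch q q i * qpoch q q (2*j)))
      has_sum (theta24 q 1 - q ^ 3 * theta24 q 17) / qpoch_inf q q) UNIV"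
proof -
  have c: "q ^ 3 = q * q\<^sup>2" by (simp add: power2_eq_square power3_eq_cube)
  have "q ^ ((i + j)\<^sup>2 + j\<^sup>2) = q ^ (i^2 + 2*i*j + 2*j^2)" for i j :: nat
    by (rule arg_cong[where f = "\<lambda>e. q ^ e"]) (simp add: power2_eq_square algebra_simps)
  then show ?thesis
    unfolding c mult.assoc using Bailey_pair_sum[of 0 0 1 q 1 5 "\<lambda>_. 1"] tsum_A_even[OF q] by simp
qed

lemma double_sum_2:
  "((\<lambda>(i, j). q ^ (i^2 + 2*i*j + 2*j^2 + i + 2*j) / (qpoch q q i * qpoch q q (2*j + 1)))
      has_sum (theta24 q 7 - q ^ 5 * theta24 q 23) / qpoch_inf q q) UNIV"
proof -
  have c: "q ^ 5 = q * q ^ 4" by (simp flip: power_Suc)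
  have "q ^ ((i + j)\<^sup>2 + (i + j) + (j\<^sup>2 + j)) = q ^ (i^2 + 2*i*j + 2*j^2 + i + 2*j)" for i j :: nat
    by (rule arg_cong[where f = "\<lambda>e. q ^ e"]) (simp add: power2_eq_square algebra_simps)
  then show ?thesis
    unfolding c mult.assoc using Bailey_pair_sum[of 1 0 1 q 1 5 "\<lambda>_. 1"] tsum_A_odd[OF q] by simp
qed

lemma double_sum_3:
  "((\<lambda>(i, j). q ^ (i^2 + 2*i*j + 2*j^2 + j) / (qpoch q q i * qpoch q q (2*j)))
      has_sum (theta24 q 2 - q ^ 2 * theta24 q 14) / qpoch_inf q q) UNIV"
proof -
  have "q ^ ((i + j)\<^sup>2 + j\<^sup>2) * q ^ j = q ^ (i^2 + 2*i*j + 2*j^2 + j)" for i j :: nat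
    unfolding power_add[symmetric]
    by (rule arg_cong[where f = "\<lambda>e. q ^ e"]) (simp add: power2_eq_square algebra_simps)
  then show ?thesis
    using Bailey_pair_sum[of 0 0 2 1 1 2 "\<lambda>j. q ^ j"] tsum_B_even[OF q] by simp
qed

lemma double_sum_4:
  "((\<lambda>(i, j). q ^ (i^2 + 2*i*j + 2*j^2 + i + 3*j) / (qpoch q q i * qpoch q q (2*j + 1)))
      has_sum (theta24 q 10 - q ^ 6 * theta24 q 26) / qpoch_inf q q) UNIV"
proof -
  have "q ^ ((i + j)\<^sup>2 + (i + j) + (j\<^sup>2 + j)) * q ^ j = q ^ (i^2 + 2*i*j + 2*j^2 + i + 3*j)" for i j :: nat
    unfolding power_add[symmetric]
    by (rule arg_cong[where f = "\<lambda>e. q ^ e"]) (simp add: power2_eq_square algebra_simps)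
  moreover have "q\<^sup>2 * (q ^ 4 * theta24 q 26) = q ^ 6 * theta24 q 26" by (simp flip: mult.assoc power_add)
  ultimately show ?thesis
    using Bailey_pair_sum[of 1 0 4 "q\<^sup>2" 1 8 "\<lambda>j. q ^ j"] tsum_B_odd[OF q] by simp
qed

text \<open>The factor 1 - q^(2j+1) from \<open>tsum_C\<close> reduces (q;q)_{2j+1} to (q;q)_{2j},
  which combines the exponent for s = 1 with the even denominator.\<close>

lemma double_sum_5:
  "((\<lambda>(i, j). q ^ (i^2 + 2*i*j + 2*j^2 + i + 2*j) / (qpoch q q i * qpoch q q (2*j)))
      has_sum (theta24 q 5 - q * theta24 q 11) / qpoch_inf q q) UNIV"
proof -
  have "q ^ ((i + j)\<^sup>2 + (i + j) + (j\<^sup>2 + j)) = q ^ (i^2 + 2*i*j + 2*j^2 + i + 2*j)" for i j :: nat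
    by (rule arg_cong[where f = "\<lambda>e. q ^ e"]) (simp add: power2_eq_square algebra_simps)
  moreover have "1 - q * q ^ (2 * j) \<noteq> 0" for j
    using q power_eq_1_iff[of q "Suc (2 * j)"] by auto
  ultimately show ?thesis
    using Bailey_pair_sum[of 1 0 "-1" q 0 5 "\<lambda>j. 1 - q ^ (2 * j + 1)"] tsum_C[OF q]
    by (simp add: qpoch_Suc)
qed

text \<open>Here the index \<open>j\<close> of the Bailey pair is shifted by one; its term at \<open>0\<close> vanishes.\<close>

lemma double_sum_6:
  "((\<lambda>(i, j). q ^ (i^2 + 2*i*j + 2*j^2 + 2*i + 4*j) / (qpoch q q i * qpoch q q (2*j + 1)))
      has_sum (theta24 q 13 - q ^ 2 * theta24 q 19) / qpoch_inf q q) UNIV"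
proof -
  let ?F = "\<lambda>(i, j). q ^ ((i + j) ^ 2 + j ^ 2) / (qpoch q q i * qpoch q q (2 * j)) * (1 - q ^ (2 * j))"
  let ?G = "\<lambda>(i, j). q ^ (i^2 + 2*i*j + 2*j^2 + 2*i + 4*j) / (qpoch q q i * qpoch q q (2*j + 1))"
  let ?S = "(theta24 q 13 - q ^ 2 * theta24 q 19) / qpoch_inf q q"
  define h :: "nat \<times> nat \<Rightarrow> nat \<times> nat" where "h = (\<lambda>(i, j). (i, j + 1))"
  \<comment> \<open>Both offsets equal 1 here, so each theta series carries q^2; replacing j by j +
    1 in the exponent yields the same q^2 on the left.\<close>
  have "(?F has_sum q\<^sup>2 * ?S) UNIV"
    using Bailey_pair_sum[of 0 1 1 "q\<^sup>2" 1 7 "\<lambda>j. 1 - q ^ (2 * j)"] tsum_D[OF q]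
    by (simp add: right_diff_distrib)
  also have "?this \<longleftrightarrow> (?F has_sum q\<^sup>2 * ?S) (range h)"
  proof (rule has_sum_cong_neutral)
    fix x assume x: "x \<in> UNIV - range h"
    obtain i j where ij: "x = (i, j)" by (cases x)
    have "x = h (i, j - 1)" if "j > 0" using that by (simp add: ij h_def)
    with x have "j = 0" by blast
    then show "?F x = 0" by (simp add: ij)
  qed auto
  also have "\<dots> \<longleftrightarrow> (?F \<circ> h has_sum q\<^sup>2 * ?S) UNIV"
    by (rule has_sum_reindex) (auto simp: h_def inj_def)
  also have "?F \<circ> h = (\<lambda>x. q\<^sup>2 * ?G x)"
  proof
    fix x :: "nat \<times> nat"
    obtain i j where ij: "x = (i, j)" by (cases x)
    have nz: "1 - q ^ (2 * (j + 1)) \<noteq> 0"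
      using q power_eq_1_iff[of q "2 * (j + 1)"] by auto
    have Q: "qpoch q q (2 * (j + 1)) = qpoch q q (2 * j + 1) * (1 - q ^ (2 * (j + 1)))"
      using qpoch_Suc[of q q "2 * j + 1"] by simp
    have E: "q ^ ((i + (j + 1)) ^ 2 + (j + 1) ^ 2) = q\<^sup>2 * q ^ (i^2 + 2*i*j + 2*j^2 + 2*i + 4*j)"
      unfolding power_add[symmetric]
      by (rule arg_cong[where f = "\<lambda>e. q ^ e"]) (simp add: power2_eq_square algebra_simps)
    have cancel: "u * v / (a * (b * c)) * c = u * (v / (a * b))" if "c \<noteq> 0" for u v a b c :: complex
      using that by simp
    show "(?F \<circ> h) x = q\<^sup>2 * ?G x"
      unfolding h_def ij o_def prod.case Q E by (rule cancel[OF nz])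
  qed
  finally show ?thesis
    using q by (subst (asm) has_sum_cmult_right_iff) auto
qed

end

lemma qpoch_inf_0: "qpoch_inf 0 q = 1"
  by (simp add: qpoch_inf_def)

text \<open>For q = 0 the Pochhammer symbols are 1, and since 0^0 = 1 only the pair (0, 0)
  contributes.\<close>

lemma has_sum_base_0:
  assumes "\<And>i j. g i j = 0 \<longleftrightarrow> i = 0 \<and> j = (0::nat)"
  shows "((\<lambda>(i, j). 0 ^ g i j / (qpoch 0 0 i * qpoch 0 0 (h j))) has_sum 1) UNIV"
proof -
  have "qpoch 0 0 n = 1" for n by (simp add: qpoch_def)
  then show ?thesis
    using assms by (intro has_sum_finite_neutralI[of "{(0, 0)}"]) (auto simp: power_0_left split: if_splits)
qed

theorem theorem5p8:
  fixes q :: complex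
  assumes "norm q < 1"
  shows "((\<lambda>(i::nat, j::nat). q ^ (i^2 + 2*i*j + 2*j^2) / (qpoch q q i * qpoch q q (2*j)))
      has_sum (qpochs_inf [q^3, q^13, q^16] (q^16) * qpochs_inf [q^10, q^22] (q^32) / qpoch_inf q q)) UNIV
    \<and> ((\<lambda>(i::nat, j::nat). q ^ (i^2 + 2*i*j + 2*j^2 + i + 2*j) / (qpoch q q i * qpoch q q (2*j + 1)))
      has_sum (qpochs_inf [q^5, q^11, q^16] (q^16) * qpochs_inf [q^6, q^26] (q^32) / qpoch_inf q q)) UNIV
    \<and> ((\<lambda>(i::nat, j::nat). q ^ (i^2 + 2*i*j + 2*j^2 + j) / (qpoch q q i * qpoch q q (2*j)))
      has_sum (qpochs_inf [q^2, q^14, q^16] (q^16) * qpochs_inf [q^12, q^20] (q^32) / qpoch_inf q q)) UNIV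
    \<and> ((\<lambda>(i::nat, j::nat). q ^ (i^2 + 2*i*j + 2*j^2 + i + 3*j) / (qpoch q q i * qpoch q q (2*j + 1)))
      has_sum (qpochs_inf [q^6, q^10, q^16] (q^16) * qpochs_inf [q^4, q^28] (q^32) / qpoch_inf q q)) UNIV
    \<and> ((\<lambda>(i::nat, j::nat). q ^ (i^2 + 2*i*j + 2*j^2 + i + 2*j) / (qpoch q q i * qpoch q q (2*j)))
      has_sum (qpochs_inf [q, q^15, q^16] (q^16) * qpochs_inf [q^14, q^18] (q^32) / qpoch_inf q q)) UNIV
    \<and> ((\<lambda>(i::nat, j::nat). q ^ (i^2 + 2*i*j + 2*j^2 + 2*i + 4*j) / (qpoch q q i * qpoch q q (2*j + 1)))
      has_sum (qpochs_inf [q^7, q^9, q^16] (q^16) * qpochs_inf [q^2, q^30] (q^32) / qpoch_inf q q)) UNIV"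
proof (cases "q = 0")
  case True
  show ?thesis
    unfolding True
    by (simp add: qpochs_inf_def qpoch_inf_0)
       (intro conjI has_sum_base_0; auto)
next
  case False
  note q = assms False
  have 1: "qpochs_inf [q^3, q^13, q^16] (q^16) * qpochs_inf [q^10, q^22] (q^32) = theta24 q 1 - q ^ 3 * theta24 q 17"
    using quintuple_theta24[OF q, of 3] by simp
  have 2: "qpochs_inf [q^5, q^11, q^16] (q^16) * qpochs_inf [q^6, q^26] (q^32) = theta24 q 7 - q ^ 5 * theta24 q 23"
    using quintuple_theta24[OF q, of 5] by simp
  have 3: "qpochs_inf [q^2, q^14, q^16] (q^16) * qpochs_inf [q^12, q^20] (q^32) = theta24 q 2 - q ^ 2 * theta24 q 14"
    using quintuple_theta24[OF q, of 2] theta24_uminus[of q 2] by simp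
  have 4: "qpochs_inf [q^6, q^10, q^16] (q^16) * qpochs_inf [q^4, q^28] (q^32) = theta24 q 10 - q ^ 6 * theta24 q 26"
    using quintuple_theta24[OF q, of 6] by simp
  have 5: "qpochs_inf [q, q^15, q^16] (q^16) * qpochs_inf [q^14, q^18] (q^32) = theta24 q 5 - q * theta24 q 11"
    using quintuple_theta24[OF q, of 1] theta24_uminus[of q 5] by simp
  \<comment> \<open>For c = 7 the quintuple product yields coefficient 29, whereas the double sum
    yields 19; the shift by 48 gives 29 - 48 = -19, and \<open>theta24\<close> is even in its
    coefficient.\<close>
  have "q ^ 5 * theta24 q 29 = theta24 q 19"
    using theta24_shift[OF q, of 29] theta24_uminus[of q 19] q
    by (simp add: power_int_minus field_simps)
  moreover have "q ^ 7 = q ^ 2 * q ^ 5" by (simp flip: power_add)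
  ultimately have "q ^ 7 * theta24 q 29 = q ^ 2 * theta24 q 19" by (simp only: mult.assoc)
  then have 6: "qpochs_inf [q^7, q^9, q^16] (q^16) * qpochs_inf [q^2, q^30] (q^32) = theta24 q 13 - q ^ 2 * theta24 q 19"
    using quintuple_theta24[OF q, of 7] by simp
  show ?thesis
    unfolding 1 2 3 4 5 6
    using double_sum_1[OF q] double_sum_2[OF q] double_sum_3[OF q] double_sum_4[OF q] double_sum_5[OF q] double_sum_6[OF q]
    by blast
qed

end
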